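(* Let $G_1,G_2,\ldots,G_n,\ldots$ be a recursively constructible sequence of graphs. Then for all $q,p\in\mathbb{Q}$ the generating functions (in the variable $y$) $$\sum_{n\ge 1} d_{\lfloor qn+p\rfloor}(G_n)\,y^n\qquad\text{and}\qquad \sum_{n\ge 1} d_{\lceil qn+p\rceil}(G_n)\,y^n$$ are algebraic.
   Context: For a finite simple graph $G$, $d_i(G)$ is the number of dominating sets of $G$ of size $i$, where $S\subseteq V(G)$ is dominating if every vertex of $G$ is in $S$ or adjacent to a vertex of $S$; $d_i(G)=0$ if $i<0$ or $i>|V(G)|$. A formal power series is algebraic if it is algebraic over the field of rational functions $\mathbb{Q}(y)$. A sequence of graphs is recursively constructible (Noy and Ribó) if it is obtained from an initial graph by repeated application of a fixed sequence of elementary operations involving addition of vertices and edges and deletion of edges. Precisely: fix $k\ge 1$ and consider finite simple graphs in which each label from $\{1,\dots,k\}$ is carried by at most one vertex and each vertex carries at most one label (vertices may be unlabelled). The elementary operations are: adding a new isolated vertex carrying label $i$ (any vertex previously carrying $i$ becomes unlabelled); changing label $i$ to label $j$ (any other vertex previously carrying $j$ becomes unlabelled); removing label $i$; adding an edge between the vertices labelled $i$ and $j$, for $i\neq j$; deleting the edge between the vertices labelled $i$ and $j$. An operation has no effect if a label it refers to (other than that of a newly added vertex) is not present, or if the edge to be added/deleted is already present/absent. The sequence $G_1,G_2,\dots$ is recursively constructible if there are $k$, an initial labelled graph $\widehat G_1$ and a fixed finite composition $F$ of elementary operations such that $\widehat G_{n+1}=F(\widehat G_n)$ for all $n\ge 1$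 and $G_n$ is the underlying unlabelled graph of $\widehat G_n$. *)

theory Defs
  imports Complex_Main "HOL-Computational_Algebra.Computational_Algebra"
begin

section \<open>Finite simple graphs and dominating sets\<close>

record 'v ugraph =
  verts :: "'v set"
  edges :: "'v set set"

definition simple_graph :: "('v, 'z) ugraph_scheme \<Rightarrow> bool" where
  "simple_graph G \<longleftrightarrow> finite (verts G) \<and>
     (\<forall>e \<in> edges G. \<exists>u \<in> verts G. \<exists>v \<in> verts G. u \<noteq> v \<and> e = {u, v})"

definition graph_iso :: "'v ugraph \<Rightarrow> 'w ugraph \<Rightarrow> bool" where
  "graph_iso G H \<longleftrightarrow>
     (\<exists>f. bij_betw f (verts G) (verts H) \<and> edges H = (\<lambda>e. f ` e) ` edges G)"

definition dominating :: "'v ugraph \<Rightarrow> 'v set \<Rightarrow> bool" where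
  "dominating G S \<longleftrightarrow> S \<subseteq> verts G \<and> (\<forall>v \<in> verts G. v \<in> S \<or> (\<exists>u \<in> S. {u, v} \<in> edges G))"

text \<open>The size is an integer, so the count is 0 for negative sizes.\<close>

definition dom_count :: "'v ugraph \<Rightarrow> int \<Rightarrow> nat" where
  "dom_count G i = card {S. dominating G S \<and> int (card S) = i}"

section \<open>Labelled graphs and elementary operations\<close>

text \<open>
  A labelling is a partial map from labels to vertices, so that a label is carried by at most
  one vertex; injectivity on its domain says that a vertex carries at most one label.
\<close>

record 'v lgraph = "'v ugraph" +
  vertex_of :: "nat \<rightharpoonup> 'v"

definition labelled_graph :: "nat \<Rightarrow> 'v lgraph \<Rightarrow> bool" where
  "labelled_graph k L \<longleftrightarrow> simple_graph L \<and> dom (vertex_of L) \<subseteq> {1..k} \<and>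
     ran (vertex_of L) \<subseteq> verts L \<and> inj_on (vertex_of L) (dom (vertex_of L))"

datatype elem_op =
    Add_Vertex nat
  | Change_Label nat nat
  | Remove_Label nat
  | Add_Edge nat nat
  | Delete_Edge nat nat

fun valid_op :: "nat \<Rightarrow> elem_op \<Rightarrow> bool" where
  "valid_op k (Add_Vertex i) \<longleftrightarrow> i \<in> {1..k}"
| "valid_op k (Change_Label i j) \<longleftrightarrow> i \<in> {1..k} \<and> j \<in> {1..k}"
| "valid_op k (Remove_Label i) \<longleftrightarrow> i \<in> {1..k}"
| "valid_op k (Add_Edge i j) \<longleftrightarrow> i \<in> {1..k} \<and> j \<in> {1..k} \<and> i \<noteq> j"
| "valid_op k (Delete_Edge i j) \<longleftrightarrow> i \<in> {1..k} \<and> j \<in> {1..k}"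

text \<open>
  Vertices are natural numbers and a new vertex is the least unused one; the choice of name is
  immaterial because recursive constructibility below is stated up to isomorphism.
\<close>

fun apply_op :: "elem_op \<Rightarrow> nat lgraph \<Rightarrow> nat lgraph" where
  "apply_op (Add_Vertex i) L =
     (let v = (LEAST v. v \<notin> verts L)
      in L\<lparr>verts := insert v (verts L), vertex_of := (vertex_of L)(i \<mapsto> v)\<rparr>)"
| "apply_op (Change_Label i j) L =
     (case vertex_of L i of
        None \<Rightarrow> L
      | Some v \<Rightarrow> L\<lparr>vertex_of := (vertex_of L)(i := None, j := Some v)\<rparr>)"
| "apply_op (Remove_Label i) L = L\<lparr>vertex_of := (vertex_of L)(i := None)\<rparr>"
| "apply_op (Add_Edge i j) L =
     (case (vertex_of L i, vertex_of L j) of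
        (Some u, Some v) \<Rightarrow> L\<lparr>edges := insert {u, v} (edges L)\<rparr>
      | _ \<Rightarrow> L)"
| "apply_op (Delete_Edge i j) L =
     (case (vertex_of L i, vertex_of L j) of
        (Some u, Some v) \<Rightarrow> L\<lparr>edges := edges L - {{u, v}}\<rparr>
      | _ \<Rightarrow> L)"

text \<open>
  The list \<open>ops\<close> is applied from left to right. Sequences start at index 1; the value at 0 is
  unconstrained.
\<close>

definition recursively_constructible :: "(nat \<Rightarrow> 'v ugraph) \<Rightarrow> bool" where
  "recursively_constructible G \<longleftrightarrow>
     (\<exists>k ops L. k \<ge> 1 \<and> (\<forall>p \<in> set ops. valid_op k p) \<and> labelled_graph k (L 1) \<and>
        (\<forall>n \<ge> 1. L (Suc n) = fold apply_op ops (L n)) \<and>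
        (\<forall>n \<ge> 1. graph_iso (ugraph.truncate (L n)) (G n)))"

section \<open>Algebraic power series\<close>

text \<open>
  The rational functions in one variable, as a subfield of the field of formal Laurent series.
\<close>

definition rational_functions :: "rat fls set" where
  "rational_functions =
     {fps_to_fls (fps_of_poly a) / fps_to_fls (fps_of_poly b) | a b. b \<noteq> 0}"

definition algebraic_fps :: "rat fps \<Rightarrow> bool" where
  "algebraic_fps f \<longleftrightarrow>
     (\<exists>P :: rat fls poly. P \<noteq> 0 \<and> (\<forall>i. coeff P i \<in> rational_functions) \<and>
        poly P (fps_to_fls f) = 0)"

end

theory Submission
  imports "HOL-Algebra.Algebraic_Closure_Type" Defs
begin

text \<open>
  Let \<open>D n\<close> be the polynomial in \<open>x\<close> that counts the dominating sets of the \<open>n\<close>-th graph by size. A vertex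
  set of a labelled graph enters later steps only through finitely many data at the labelled
  vertices, among them the edges between these, since such edges may still be deleted. One round
  of operations is therefore a fixed linear map, with polynomial entries, of the vector that counts
  vertex sets by state (\<open>transfer_fold\<close>). As this vector lives in a module of finite rank, the polynomials
  \<open>D n\<close> satisfy a linear recurrence with coefficients that are polynomials in \<open>x\<close>
  (\<open>domination_poly_recurrence\<close>), and their generating function in \<open>y\<close> is a rational function of \<open>x\<close>
  and \<open>y\<close>.

  For slope \<open>a / b\<close> the coefficients of the \<open>D n\<close> along a rounded line add up from \<open>b\<close> sequences of the form:
  the coefficient of \<open>x ^ i\<close> in \<open>D n (x ^ b) * x ^ (- a * n)\<close>, for fixed \<open>i\<close> (\<open>line_algebraic\<close>). Let \<open>c i\<close> be the
  generating function in \<open>y\<close> of such a sequence. Together, the \<open>c i\<close> form an expansion of a rational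
  function, infinite in both directions: for some polynomial \<open>Q\<close> in \<open>x\<close> over the rational functions in \<open>y\<close>,
  the product of \<open>Q\<close> with the sum of the \<open>c i * x ^ i\<close> is a Laurent polynomial. Moreover, every power
  of \<open>y\<close> occurs in finitely many \<open>c i\<close> only.

  That such \<open>c i\<close> are algebraic is the classical theorem on diagonals of bivariate rational
  functions, usually proved by summing residues at the roots of \<open>Q\<close> that are small Puiseux series. Here
  (\<open>decaying_solution_algebraic\<close>) small and large roots are separated by two divisors of \<open>Q\<close>: the
  polynomials of least degree whose products with \<open>c\<close> vanish far to the right and far to the left. Their
  coefficients are symmetric functions of roots of \<open>Q\<close>, hence algebraic, and they are coprime
  (\<open>one_sided_annihilators_coprime\<close>) because a common factor would have an inverse that is at the same time
  finite to the left and to the right. Multiplied by either divisor, \<open>c\<close> becomes one-sided and can be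
  computed recursively inside the field of algebraic series; a combination of the two products
  gives back \<open>c\<close>.
\<close>

section \<open>Homogeneous linear systems over an integral domain\<close>

text \<open>
  Fraction-free Gaussian elimination: multiplying by the pivot instead of dividing by it keeps
  the solution in the ring. Over the ring of polynomials it turns a transfer matrix into a
  linear recurrence with polynomial coefficients.
\<close>

lemma homogeneous_system:
  fixes A :: "'i \<Rightarrow> 'j \<Rightarrow> 'a::idom"
  assumes "finite I" "finite J" "card I < card J"
  shows "\<exists>v. (\<exists>j\<in>J. v j \<noteq> 0) \<and> (\<forall>i\<in>I. (\<Sum>j\<in>J. v j * A i j) = 0)"
  using assms
proof (induction I arbitrary: J A rule: finite_induct)
  case empty
  then obtain j where "j \<in> J" by fastforce
  then show ?case by (intro exI[of _ "\<lambda>_. 1"]) auto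
next
  case (insert i0 I)
  show ?case
  proof (cases "\<forall>j\<in>J. A i0 j = 0")
    case True
    have "card I < card J" using insert by simp
    from insert.IH[OF insert.prems(1) this, of A] obtain v where
      "\<exists>j\<in>J. v j \<noteq> 0" "\<forall>i\<in>I. (\<Sum>j\<in>J. v j * A i j) = 0" by blast
    then show ?thesis using True by (intro exI[of _ v]) simp
  next
    case False
    then obtain p where p: "p \<in> J" "A i0 p \<noteq> 0" by blast
    define J' where "J' = J - {p}"
    have J': "finite J'" "J = insert p J'" "p \<notin> J'" using insert.prems p by (auto simp: J'_def)
    have "card I < card J'" using insert J' by simp
    from insert.IH[OF J'(1) this, of "\<lambda>i j. A i0 p * A i j - A i p * A i0 j"] obtain v where
      v: "\<exists>j\<in>J'. v j \<noteq> 0" "\<And>i. i \<in> I \<Longrightarrow> (\<Sum>j\<in>J'. v j * (A i0 p * A i j - A i p * A i0 j)) = 0"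
      by blast
    \<comment> \<open>The pivot coordinate is chosen to satisfy equation \<open>i0\<close>.\<close>
    define w where "w j = (if j = p then - (\<Sum>j\<in>J'. v j * A i0 j) else A i0 p * v j)" for j
    have w: "(\<Sum>j\<in>J. w j * A i j) =
        - (\<Sum>j\<in>J'. v j * A i0 j) * A i p + (\<Sum>j\<in>J'. A i0 p * v j * A i j)" for i
    proof -
      have "(\<Sum>j\<in>J'. w j * A i j) = (\<Sum>j\<in>J'. A i0 p * v j * A i j)"
        by (rule sum.cong) (use J'(3) in \<open>auto simp: w_def\<close>)
      then show ?thesis using J' by (simp add: w_def)
    qed
    have w': "(\<Sum>j\<in>J. w j * A i j) = (\<Sum>j\<in>J'. v j * (A i0 p * A i j - A i p * A i0 j))" for i
      unfolding w by (simp add: sum_distrib_left sum_distrib_right sum_subtractf algebra_simps)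
    have "(\<Sum>j\<in>J. w j * A i j) = 0" if "i \<in> insert i0 I" for i
      using that v(2) by (auto simp: w')
    moreover have "\<exists>j\<in>J. w j \<noteq> 0" using v(1) J' p by (auto simp: w_def)
    ultimately show ?thesis by blast
  qed
qed

section \<open>Algebraic elements over a subfield\<close>

definition is_subfield :: "'a::field set \<Rightarrow> bool" where
  "is_subfield K \<longleftrightarrow> 0 \<in> K \<and> 1 \<in> K \<and>
     (\<forall>x\<in>K. \<forall>y\<in>K. x - y \<in> K \<and> x * y \<in> K \<and> x / y \<in> K)"

definition coeffs_in :: "'a::zero set \<Rightarrow> 'a poly \<Rightarrow> bool" where
  "coeffs_in K p \<longleftrightarrow> (\<forall>i. coeff p i \<in> K)"

definition algebraics :: "'a::field set \<Rightarrow> 'a set" where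
  "algebraics K = {x. \<exists>p. p \<noteq> 0 \<and> coeffs_in K p \<and> poly p x = 0}"

context
  fixes K :: "'a::field set"
  assumes K: "is_subfield K"
begin

lemma is_subfield_simps:
  "0 \<in> K" "1 \<in> K" "x \<in> K \<Longrightarrow> y \<in> K \<Longrightarrow> x - y \<in> K" "x \<in> K \<Longrightarrow> y \<in> K \<Longrightarrow> x * y \<in> K"
  "x \<in> K \<Longrightarrow> y \<in> K \<Longrightarrow> x / y \<in> K" "x \<in> K \<Longrightarrow> - x \<in> K" "x \<in> K \<Longrightarrow> y \<in> K \<Longrightarrow> x + y \<in> K"
proof -
  show *: "0 \<in> K" "1 \<in> K" "\<And>x y. x \<in> K \<Longrightarrow> y \<in> K \<Longrightarrow> x - y \<in> K"
    "x \<in> K \<Longrightarrow> y \<in> K \<Longrightarrow> x * y \<in> K" "x \<in> K \<Longrightarrow> y \<in> K \<Longrightarrow> x / y \<in> K" for x y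
    using K by (auto simp: is_subfield_def)
  show **: "- x \<in> K" if "x \<in> K" for x using *(3)[of 0 x] *(1) that by simp
  show "x + y \<in> K" if "x \<in> K" "y \<in> K" for x y using *(3)[of x "- y"] ** that by simp
qed

lemma is_subfield_sum: "(\<And>i. i \<in> I \<Longrightarrow> f i \<in> K) \<Longrightarrow> sum f I \<in> K"
  by (induction I rule: infinite_finite_induct) (auto intro: is_subfield_simps)

lemma coeffs_in_mult:
  assumes "coeffs_in K p" "coeffs_in K q" shows "coeffs_in K (p * q)"
  using assms unfolding coeffs_in_def coeff_mult
  by (auto intro!: is_subfield_sum is_subfield_simps)

end

text \<open>
  Structures with explicit carriers represent polynomials as lists, leading coefficient first.
  This translation makes the theorem that algebraic elements form a subfield, which is known
  for such structures, applicable to a subset of a field type.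
\<close>

lemma eval_eq_poly:
  "ring.eval (ring_of_type_algebra :: 'a::field ring) xs x = poly (Poly (rev xs)) x"
proof -
  interpret R: field "ring_of_type_algebra :: 'a ring" by (rule field_from_type_algebra)
  have pw: "x [^]\<^bsub>ring_of_type_algebra\<^esub> n = x ^ n" for n :: nat
    by (induction n) (simp_all add: ring_of_type_algebra_def nat_pow_def mult.commute)
  show ?thesis
  proof (induction xs)
    case Nil
    show ?case unfolding R.eval.simps by (simp add: ring_of_type_algebra_def)
  next
    case (Cons a xs)
    then show ?case
      unfolding R.eval.simps list.sel pw
      by (simp add: ring_of_type_algebra_def Poly_append poly_monom algebra_simps)
  qed
qed

lemma is_subfield_algebraics:
  assumes "is_subfield (K :: 'a::field set)"
  shows "is_subfield (algebraics K)" "K \<subseteq> algebraics K"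
proof -
  let ?R = "ring_of_type_algebra :: 'a ring"
  interpret R: field ?R by (rule field_from_type_algebra)
  have R: "carrier ?R = UNIV" "\<zero>\<^bsub>?R\<^esub> = 0" "\<one>\<^bsub>?R\<^esub> = 1" "\<And>x y. x \<oplus>\<^bsub>?R\<^esub> y = x + y"
    "\<And>x y. x \<otimes>\<^bsub>?R\<^esub> y = x * y"
    by (auto simp: ring_of_type_algebra_def)
  have um: "\<ominus>\<^bsub>?R\<^esub> x = - x" for x
    using R.minus_equality[of "- x" x] by (simp add: R)
  have iv: "inv\<^bsub>?R\<^esub> x = inverse x" if "x \<noteq> 0" for x
    using that R.comm_inv_char[of x "inverse x"] by (simp add: R)
  note Ks = is_subfield_simps[OF assms]
  have "subring K ?R"
    by (rule R.subringI) (auto simp: R um intro: Ks)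
  then have sub: "subfield K ?R"
    by (rule R.subfieldI') (use Ks in \<open>auto simp: R iv inverse_eq_divide\<close>)
  have alg: "(R.algebraic over K) x \<longleftrightarrow> x \<in> algebraics K" for x
  proof
    assume "(R.algebraic over K) x"
    then obtain p where p: "p \<in> carrier (K[X]\<^bsub>?R\<^esub>)" "p \<noteq> []" "R.eval p x = \<zero>\<^bsub>?R\<^esub>"
      using R.algebraicE[OF \<open>subring K ?R\<close>, of x] by (auto simp: R)
    have s: "set p \<subseteq> K" "hd p \<noteq> 0"
      using p by (auto simp: univ_poly_def polynomial_def R)
    have c: "coeff (Poly (rev p)) i \<in> K" for i
      using s Ks(1) by (auto simp: nth_default_def coeff_Poly_eq rev_nth)
    have "Poly (rev p) \<noteq> 0"
      using s(2) p(2) by (metis Poly_eq_0 hd_in_set hd_replicate hd_rev in_set_replicate last_rev rev_rev_ident set_rev rev_is_Nil_conv replicate_0)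
    then show "x \<in> algebraics K"
      using p(3) c unfolding algebraics_def eval_eq_poly by (auto simp: R coeffs_in_def over_def)
  next
    assume "x \<in> algebraics K"
    then obtain p where p: "p \<noteq> 0" "\<And>i. coeff p i \<in> K" "poly p x = 0"
      by (auto simp: algebraics_def coeffs_in_def)
    show "(R.algebraic over K) x"
    proof (rule R.algebraicI)
      show "rev (coeffs p) \<in> carrier (K[X]\<^bsub>?R\<^esub>)"
        using p by (auto simp: univ_poly_def polynomial_def R coeffs_def hd_rev last_coeffs_eq_coeff_degree)
      show "rev (coeffs p) \<noteq> []" using p by simp
      show "R.eval (rev (coeffs p)) x = \<zero>\<^bsub>?R\<^esub>" using p by (simp add: eval_eq_poly R)
    qed
  qed
  have S: "subfield (algebraics K) ?R"
    using R.subfield_of_algebraics[OF sub] by (simp add: alg R)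
  note S1 = subringE[OF subfieldE(1)[OF S], unfolded R um]
  have dv: "x / y \<in> algebraics K" if "x \<in> algebraics K" "y \<in> algebraics K" for x y
  proof (cases "y = 0")
    case False
    then have "inverse y \<in> algebraics K"
      using R.subfield_m_inv(1)[OF S, of y] that by (simp add: R iv)
    then show ?thesis using that S1(6) by (simp add: divide_inverse)
  qed (use S1 in simp)
  show "is_subfield (algebraics K)"
    unfolding is_subfield_def using S1 dv by (metis diff_conv_add_uminus)
  show "K \<subseteq> algebraics K"
    using R.algebraic_self[OF \<open>subring K ?R\<close>] by (auto simp: alg)
qed

text \<open>
  In the algebraic closure \<open>U\<close> splits into factors \<open>x - r\<close>, every root \<open>r\<close> is a root of \<open>Q\<close> and so
  algebraic over \<open>K\<close>, and the coefficients of \<open>U\<close> are polynomials in these roots.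
\<close>

lemma coeffs_in_divisor:
  fixes Q U :: "'a::field poly"
  assumes K: "is_subfield K" and "coeffs_in K Q" "Q \<noteq> 0" "U dvd Q" "lead_coeff U = 1"
  shows "coeffs_in (algebraics K) U"
proof -
  define K' where "K' = to_ac ` K"
  have K': "is_subfield K'"
    using K unfolding is_subfield_def K'_def
    by (auto simp flip: to_ac_diff to_ac_mult to_ac_divide simp del: to_ac_diff to_ac_mult to_ac_divide
        intro: image_eqI[of _ _ 0] image_eqI[of _ _ 1])
  note A = is_subfield_simps[OF is_subfield_algebraics(1)[OF K']]
  have ev: "poly (map_poly to_ac p) (to_ac x) = to_ac (poly p x)" for p :: "'a poly" and x
    by (induction p) (simp_all add: map_poly_pCons)
  have mult: "map_poly to_ac (p * q) = map_poly to_ac p * map_poly to_ac q" for p q :: "'a poly"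
    by (rule poly_eqI) (simp add: coeff_map_poly coeff_mult to_ac_sum)
  have U0: "U \<noteq> 0" using assms by auto
  have lc: "lead_coeff (map_poly to_ac U) = 1"
    using assms(5) by (simp add: coeff_map_poly degree_map_poly)
  then have "map_poly to_ac U \<noteq> 0" by auto
  from alg_closed_imp_factorization[OF this] lc obtain R where
    R: "map_poly to_ac U = (\<Prod>x\<in>#R. [:-x, 1:])" by auto
  have root: "r \<in> algebraics K'" if "r \<in># R" for r
  proof -
    have "poly (map_poly to_ac U) r = 0"
      using that unfolding R by (auto simp: poly_prod_mset prod_mset_zero_iff)
    then have "poly (map_poly to_ac Q) r = 0"
      using \<open>U dvd Q\<close> by (auto simp: mult elim!: dvdE)
    moreover have "coeffs_in K' (map_poly to_ac Q)"
      using assms(2) by (auto simp: coeffs_in_def coeff_map_poly K'_def)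
    moreover have "map_poly to_ac Q \<noteq> 0"
      using assms(3) by (simp add: map_poly_eq_0_iff)
    ultimately show ?thesis by (auto simp: algebraics_def)
  qed
  have "coeffs_in (algebraics K') (\<Prod>x\<in>#S. [:-x, 1:])" if "set_mset S \<subseteq> algebraics K'" for S
    using that
  proof (induction S)
    case empty
    then show ?case using A by (auto simp: coeffs_in_def coeff_1)
  next
    case (add x S)
    have "coeffs_in (algebraics K') [:-x, 1:]"
      using add A by (auto simp: coeffs_in_def coeff_pCons split: nat.split)
    then show ?case
      using add coeffs_in_mult[OF is_subfield_algebraics(1)[OF K'], of "[:-x, 1:]"]
      by (simp del: mult_pCons_left)
  qed
  then have "coeffs_in (algebraics K') (map_poly to_ac U)"
    using root unfolding R by blast
  then have *: "to_ac (coeff U i) \<in> algebraics K'" for i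
    by (simp add: coeffs_in_def coeff_map_poly)
  show ?thesis unfolding coeffs_in_def
  proof
    fix i
    obtain p where p: "p \<noteq> 0" "coeffs_in K' p" "poly p (to_ac (coeff U i)) = 0"
      using *[of i] by (auto simp: algebraics_def)
    define q where "q = map_poly of_ac p"
    have cq: "coeff q n \<in> K" and "to_ac (coeff q n) = coeff p n" for n
      using p(2) by (auto simp: q_def coeff_map_poly coeffs_in_def K'_def image_iff) (metis of_ac_to_ac)+
    then have q: "map_poly to_ac q = p" by (intro poly_eqI) (simp add: coeff_map_poly)
    then have "q \<noteq> 0" "poly q (coeff U i) = 0"
      using p ev[of q "coeff U i"] by auto
    then show "coeff U i \<in> algebraics K"
      using cq by (auto simp: algebraics_def coeffs_in_def)
  qed
qed

text \<open>
  Division with remainder by an element of least degree. Only scalars from \<open>K\<close> occur in the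
  division, so \<open>J\<close> may be an ideal of the polynomial ring over \<open>K\<close> alone; divisibility is
  still stated over the whole field.
\<close>

lemma ideal_generator:
  fixes J :: "'a::field poly set"
  assumes K: "is_subfield K" and J: "\<And>f. f \<in> J \<Longrightarrow> coeffs_in K f"
    "\<And>f g a n. f \<in> J \<Longrightarrow> g \<in> J \<Longrightarrow> a \<in> K \<Longrightarrow> f - monom a n * g \<in> J"
    and ne: "h \<in> J" "h \<noteq> 0"
  shows "\<exists>d\<in>J. lead_coeff d = 1 \<and> (\<forall>f\<in>J. d dvd f)"
proof -
  note Ks = is_subfield_simps[OF K]
  obtain d where d: "d \<in> J" "d \<noteq> 0" and min: "\<And>f. f \<in> J \<Longrightarrow> f \<noteq> 0 \<Longrightarrow> degree d \<le> degree f"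
    using ex_has_least_nat[of "\<lambda>f. f \<in> J \<and> f \<noteq> 0" h degree] ne by blast
  have dvd: "d dvd f" if "f \<in> J" for f
    using that
  proof (induction "degree f" arbitrary: f rule: less_induct)
    case less
    show ?case
    proof (cases "f = 0")
      case False
      define a where "a = lead_coeff f / lead_coeff d"
      define g where "g = f - monom a (degree f - degree d) * d"
      have a: "a \<in> K" using J(1)[OF less.prems] J(1)[OF d(1)] Ks by (auto simp: a_def coeffs_in_def)
      have g: "g \<in> J" unfolding g_def by (rule J(2)[OF less.prems d(1) a])
      have a0: "a \<noteq> 0" using False d by (simp add: a_def)
      have dg: "degree (monom a (degree f - degree d) * d) = degree f"
        using a0 d min[OF less.prems False] by (simp add: degree_mult_eq degree_monom_eq)
      have "coeff (monom a (degree f - degree d) * d) (degree f) = lead_coeff f"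
        using min[OF less.prems False] d by (simp add: coeff_monom_mult a_def)
      then have cg: "coeff g (degree f) = 0" by (simp add: g_def)
      have "degree g \<le> degree f"
        unfolding g_def using dg by (metis degree_diff_le order_refl)
      have "d dvd g"
      proof (cases "g = 0")
        case False
        then have "degree g \<noteq> degree f" using cg by (metis leading_coeff_0_iff)
        then show ?thesis using less.hyps[of g] g \<open>degree g \<le> degree f\<close> by simp
      qed simp
      then have "d dvd g + monom a (degree f - degree d) * d" by (intro dvd_add) auto
      then show ?thesis by (simp add: g_def)
    qed simp
  qed
  define e where "e = smult (inverse (lead_coeff d)) d"
  have "d - monom 1 0 * d \<in> J" by (rule J(2)) (use d Ks in auto)
  then have "0 \<in> J" by (simp add: monom_0)
  have "0 - monom (- inverse (lead_coeff d)) 0 * d \<in> J"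
    by (rule J(2)[OF \<open>0 \<in> J\<close> d(1)])
      (use J(1)[OF d(1)] Ks in \<open>auto simp: coeffs_in_def inverse_eq_divide\<close>)
  then have "e \<in> J" by (simp add: e_def monom_0)
  moreover have "lead_coeff e = 1" using d by (simp add: e_def)
  moreover have "e dvd f" if "f \<in> J" for f
    using dvd[OF that] d by (simp add: e_def smult_dvd_iff)
  ultimately show ?thesis by blast
qed

section \<open>Polynomials acting on doubly infinite sequences\<close>

text \<open>
  A sequence \<open>c\<close> stands for the formal sum of the \<open>c i * x ^ i\<close> over all integers \<open>i\<close>. Two such sums
  have no product, but each can be multiplied by a polynomial; this is the resulting module
  structure.
\<close>

definition act :: "'a::comm_ring_1 poly \<Rightarrow> (int \<Rightarrow> 'a) \<Rightarrow> int \<Rightarrow> 'a" where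
  "act f c i = (\<Sum>j\<le>degree f. coeff f j * c (i - int j))"

lemma act_eq: "degree f \<le> n \<Longrightarrow> act f c i = (\<Sum>j\<le>n. coeff f j * c (i - int j))"
  unfolding act_def by (rule sum.mono_neutral_left) (auto intro: le_degree)

lemma act_0 [simp]: "act 0 c i = 0"
  by (simp add: act_def)

lemma act_pCons: "act (pCons a f) c i = a * c i + act f c (i - 1)"
proof -
  have "act (pCons a f) c i = (\<Sum>j\<le>Suc (degree f). coeff (pCons a f) j * c (i - int j))"
    by (rule act_eq) (rule degree_pCons_le)
  also have "\<dots> = a * c i + act f c (i - 1)"
    unfolding sum.atMost_Suc_shift by (simp add: act_def algebra_simps)
  finally show ?thesis .
qed

lemma act_add_poly: "act (f + g) c i = act f c i + act g c i"
proof -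
  let ?n = "max (degree f) (degree g)"
  show ?thesis
    using act_eq[of f ?n c i] act_eq[of g ?n c i] act_eq[of "f + g" ?n c i] degree_add_le_max[of f g]
    by (simp add: sum.distrib algebra_simps)
qed

lemma act_smult: "act (smult a f) c i = a * act f c i"
  by (induction f arbitrary: i) (simp_all add: act_pCons algebra_simps)

lemma act_diff_poly: "act (f - g) c i = act f c i - act g c i"
  using act_add_poly[of "f - g" g c i] by simp

lemma act_mult: "act (f * g) c i = act f (act g c) i"
  by (induction f arbitrary: i) (simp_all add: act_pCons act_add_poly act_smult)

lemma act_commute: "act f (act g c) i = act g (act f c) i"
  by (metis act_mult mult.commute)

lemma act_add: "act f (\<lambda>i. c i + d i) i = act f c i + act f d i"
  by (simp add: act_def sum.distrib algebra_simps)

lemma act_diff: "act f (\<lambda>i. c i - d i) i = act f c i - act f d i"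
  by (simp add: act_def sum_subtractf algebra_simps)

lemma act_shift: "act f (\<lambda>i. c (i - k)) i = act f c (i - k)"
  by (simp add: act_def algebra_simps)

lemma act_monom: "act (monom a n) c i = a * c (i - int n)"
  by (induction n arbitrary: i) (simp_all add: monom_0 monom_Suc act_pCons algebra_simps)

lemma act_1 [simp]: "act 1 c i = c i"
  using act_monom[of 1 0 c i] by (simp add: monom_0 one_pCons)

lemma act_sum_poly: "act (\<Sum>x\<in>A. f x) c i = (\<Sum>x\<in>A. act (f x) c i)"
  by (induction A rule: infinite_finite_induct) (simp_all add: act_add_poly)

definition delta :: "int \<Rightarrow> 'a::comm_ring_1" where
  "delta i = (if i = 0 then 1 else 0)"

lemma act_delta: "act f delta i = (if i < 0 then 0 else coeff f (nat i))"
  by (induction f arbitrary: i)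
    (auto simp: act_pCons delta_def coeff_pCons nat_diff_distrib' split: nat.split)

lemma act_delta_inject: "(\<And>i. act f delta i = act g delta i) \<Longrightarrow> f = g"
  by (rule poly_eqI) (metis act_delta nat_int of_nat_less_0_iff)

definition right_finite :: "(int \<Rightarrow> 'a::zero) \<Rightarrow> bool" where
  "right_finite c \<longleftrightarrow> (\<exists>N. \<forall>i>N. c i = 0)"

definition left_finite :: "(int \<Rightarrow> 'a::zero) \<Rightarrow> bool" where
  "left_finite c \<longleftrightarrow> (\<exists>N. \<forall>i<N. c i = 0)"

lemma right_finite_act: "right_finite c \<Longrightarrow> right_finite (act f c)"
proof -
  assume "right_finite c"
  then obtain N where N: "\<And>i. i > N \<Longrightarrow> c i = 0" by (auto simp: right_finite_def)
  have "act f c i = 0" if "i > N + int (degree f)" for i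
    unfolding act_def by (rule sum.neutral) (use N that in auto)
  then show ?thesis by (auto simp: right_finite_def)
qed

lemma left_finite_act: "left_finite c \<Longrightarrow> left_finite (act f c)"
proof -
  assume "left_finite c"
  then obtain N where N: "\<And>i. i < N \<Longrightarrow> c i = 0" by (auto simp: left_finite_def)
  have "act f c i = 0" if "i < N" for i
    unfolding act_def by (rule sum.neutral) (use N that in auto)
  then show ?thesis by (auto simp: left_finite_def)
qed

lemma right_finite_add:
  fixes c d :: "int \<Rightarrow> 'a::comm_ring_1"
  assumes "right_finite c" "right_finite d" shows "right_finite (\<lambda>i. c i + d i)"
proof -
  obtain N M where N: "\<And>i. i > N \<Longrightarrow> c i = 0" "\<And>i. i > M \<Longrightarrow> d i = 0"
    using assms by (auto simp: right_finite_def)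
  then show ?thesis unfolding right_finite_def by (intro exI[of _ "max N M"]) auto
qed

lemma left_finite_add:
  fixes c d :: "int \<Rightarrow> 'a::comm_ring_1"
  assumes "left_finite c" "left_finite d" shows "left_finite (\<lambda>i. c i + d i)"
proof -
  obtain N M where N: "\<And>i. i < N \<Longrightarrow> c i = 0" "\<And>i. i < M \<Longrightarrow> d i = 0"
    using assms by (auto simp: left_finite_def)
  then show ?thesis unfolding left_finite_def by (intro exI[of _ "min N M"]) auto
qed

lemma right_finite_shift: "right_finite c \<Longrightarrow> right_finite (\<lambda>i. c (i - k))"
  unfolding right_finite_def by (metis add.commute less_diff_eq)

lemma left_finite_shift: "left_finite c \<Longrightarrow> left_finite (\<lambda>i. c (i - k))"
  unfolding left_finite_def by (metis diff_less_eq)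

lemma finite_delta: "right_finite delta" "left_finite delta"
  by (auto simp: right_finite_def left_finite_def delta_def intro: exI[of _ 0])

lemma finite_seq_poly:
  assumes "left_finite c" "right_finite c"
  shows "\<exists>k P. \<forall>i. c (i - int k) = act P delta i"
proof -
  obtain N M where N: "\<And>i. i < N \<Longrightarrow> c i = 0" "\<And>i. i > M \<Longrightarrow> c i = 0"
    using assms by (auto simp: left_finite_def right_finite_def)
  define k where "k = nat (- N)"
  define P where "P = (\<Sum>j\<le>nat (M + int k). monom (c (int j - int k)) j)"
  have P: "coeff P j = c (int j - int k)" for j
    using N(2)[of "int j - int k"] by (auto simp: P_def coeff_sum)
  have "c (i - int k) = act P delta i" for i
    using N(1)[of "i - int k"] by (auto simp: act_delta P k_def)
  then show ?thesis by blast
qed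

section \<open>Sequences with coefficients of growing order\<close>

definition ord_ge :: "int \<Rightarrow> 'a::zero fls \<Rightarrow> bool" where
  "ord_ge n a \<longleftrightarrow> (\<forall>m<n. fls_nth a m = 0)"

lemma ord_ge_iff: "ord_ge n a \<longleftrightarrow> a = 0 \<or> n \<le> fls_subdegree a"
  unfolding ord_ge_def by (metis fls_eq0_below_subdegree fls_subdegree_geI fls_zero_nth linorder_not_less order_less_le_trans)

lemma ord_ge_add: "ord_ge n a \<Longrightarrow> ord_ge n b \<Longrightarrow> ord_ge n (a + b :: 'a::comm_ring_1 fls)"
  by (simp add: ord_ge_def)

lemma ord_ge_mult:
  fixes a b :: "'a::field fls"
  assumes "ord_ge m a" "ord_ge n b"
  shows "ord_ge (m + n) (a * b)" "fls_nth (a * b) (m + n) = fls_nth a m * fls_nth b n"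
proof -
  show 1: "ord_ge (m + n) (a * b)"
    using assms by (cases "a = 0 \<or> b = 0") (auto simp: ord_ge_iff)
  show "fls_nth (a * b) (m + n) = fls_nth a m * fls_nth b n"
  proof (cases "a = 0 \<or> b = 0")
    case False
    then have le: "m \<le> fls_subdegree a" "n \<le> fls_subdegree b" using assms by (auto simp: ord_ge_iff)
    show ?thesis
    proof (cases "m = fls_subdegree a \<and> n = fls_subdegree b")
      case False
      then have "m < fls_subdegree a \<or> n < fls_subdegree b" using le by auto
      moreover have "m + n < fls_subdegree a + fls_subdegree b" using False le by auto
      ultimately show ?thesis by (auto simp: fls_times_nth_eq0)
    qed (simp del: fls_subdegree_mult)
  qed auto
qed

text \<open>
  The coefficients tend to 0 in the adic topology at both ends. This is what a Laurent
  polynomial in \<open>x\<close> for each power of the series variable amounts to, and it singles out one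
  expansion of a rational function among all those that exist as formal sums.
\<close>

definition decays :: "(int \<Rightarrow> 'a::zero fls) \<Rightarrow> bool" where
  "decays c \<longleftrightarrow> (\<forall>n. finite {i. \<not> ord_ge n (c i)})"

lemma decaysD: "decays c \<Longrightarrow> finite {i. \<not> ord_ge n (c i)}"
  by (simp add: decays_def)

lemma decays_add:
  fixes c d :: "int \<Rightarrow> 'a::comm_ring_1 fls"
  assumes "decays c" "decays d" shows "decays (\<lambda>i. c i + d i)"
  unfolding decays_def
proof
  fix n
  have "{i. \<not> ord_ge n (c i + d i)} \<subseteq> {i. \<not> ord_ge n (c i)} \<union> {i. \<not> ord_ge n (d i)}"
    using ord_ge_add by blast
  then show "finite {i. \<not> ord_ge n (c i + d i)}"
    using decaysD[OF assms(1), of n] decaysD[OF assms(2), of n] by (rule finite_subset[OF _ finite_UnI])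
qed

lemma decays_shift:
  assumes "decays c" shows "decays (\<lambda>i. c (i - k))"
  unfolding decays_def
proof
  fix n
  have "{i. \<not> ord_ge n (c (i - k))} = (\<lambda>i. i + k) ` {i. \<not> ord_ge n (c i)}"
    by (auto simp: image_iff) (metis diff_add_cancel)
  then show "finite {i. \<not> ord_ge n (c (i - k))}"
    using assms by (simp add: decays_def)
qed

lemma decays_mult:
  fixes a :: "'a::field fls"
  assumes "decays c" shows "decays (\<lambda>i. a * c i)"
  unfolding decays_def
proof
  fix n
  define m where "m = fls_subdegree a"
  have "ord_ge m a" by (simp add: ord_ge_iff m_def)
  then have "{i. \<not> ord_ge n (a * c i)} \<subseteq> {i. \<not> ord_ge (n - m) (c i)}"
    using ord_ge_mult(1)[of m a "n - m"] by auto
  then show "finite {i. \<not> ord_ge n (a * c i)}"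
    using decaysD[OF assms] by (rule finite_subset)
qed

lemma decays_act:
  fixes f :: "'a::field fls poly"
  assumes "decays c" shows "decays (act f c)"
proof (induction f)
  case 0
  then show ?case by (simp add: decays_def ord_ge_def)
next
  case (pCons a f)
  show ?case
    using decays_add[OF decays_mult[OF assms, of a] decays_shift[OF pCons(2), of 1]]
    by (simp add: decays_def act_pCons)
qed

lemma decays_delta: "decays (delta :: int \<Rightarrow> 'a::field fls)"
proof -
  have "{i. \<not> ord_ge n (delta i :: 'a fls)} \<subseteq> {0}" for n
    by (auto simp: delta_def ord_ge_def)
  then show ?thesis unfolding decays_def by (meson finite.intros finite_subset)
qed

lemma decays_restrict: "decays c \<Longrightarrow> decays (\<lambda>i. if P i then c i else 0)"
  unfolding decays_def by (rule allI, rule finite_subset[of _ "{i. \<not> ord_ge n (c i)}" for n]) (auto simp: ord_ge_def)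

text \<open>
  Among the terms of least order there is one of largest index. Comparing such extremal terms
  is the argument of Gauss's lemma, used below to exclude zero divisors.
\<close>

lemma ex_dominant:
  assumes fin: "\<And>n. finite {i::'i::linorder. \<not> ord_ge n (c i)}" and ne: "c i0 \<noteq> 0"
  shows "\<exists>m i1. fls_nth (c i1) m \<noteq> 0 \<and> (\<forall>i. ord_ge m (c i)) \<and> (\<forall>i>i1. fls_nth (c i) m = 0)"
proof -
  define S where "S = {i. \<not> ord_ge (fls_subdegree (c i0) + 1) (c i)}"
  have S: "finite S" "i0 \<in> S" using ne fin by (auto simp: S_def ord_ge_iff)
  define m where "m = Min ((\<lambda>i. fls_subdegree (c i)) ` S)"
  have "m \<in> (\<lambda>i. fls_subdegree (c i)) ` S" unfolding m_def by (rule Min_in) (use S in auto)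
  then obtain i2 where i2: "i2 \<in> S" "m = fls_subdegree (c i2)" by blast
  have m: "m \<le> fls_subdegree (c i)" if "i \<in> S" for i
    unfolding m_def by (rule Min_le) (use S that in auto)
  have ge: "ord_ge m (c i)" for i
    using m[of i] m[of i0] S(2) by (cases "i \<in> S") (auto simp: S_def ord_ge_iff)
  define T where "T = {i. fls_nth (c i) m \<noteq> 0}"
  have "T \<subseteq> {i. \<not> ord_ge (m + 1) (c i)}" by (auto simp: T_def ord_ge_def intro: exI[of _ m])
  then have T: "finite T" using fin finite_subset by blast
  have "i2 \<in> T" using i2 by (auto simp: T_def S_def ord_ge_iff)
  then have "Max T \<in> T" using T by (intro Max_in) auto
  then obtain i1 where i1: "i1 = Max T" "i1 \<in> T" by blast
  have "fls_nth (c i) m = 0" if "i > i1" for i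
    using that Max_ge[OF T, of i] unfolding i1(1) by (cases "i \<in> T") (auto simp: T_def)
  moreover have "fls_nth (c i1) m \<noteq> 0" using i1(2) by (simp add: T_def)
  ultimately show ?thesis using ge by blast
qed

text \<open>
  Decaying sequences form a torsion-free module: the product of the dominant terms of \<open>f\<close> and \<open>c\<close>
  is not cancelled by any other product. Without decay this fails, since the constant
  sequence 1 is annihilated by \<open>x - 1\<close>.
\<close>

lemma act_eq_0_imp_eq_0:
  fixes c :: "int \<Rightarrow> 'a::field fls"
  assumes c: "decays c" and f: "f \<noteq> 0" and eq: "\<And>i. act f c i = 0"
  shows "c i = 0"
proof (rule ccontr)
  assume "c i \<noteq> 0"
  from ex_dominant[of c i, OF decaysD[OF c] this] obtain m i1 where
    m: "fls_nth (c i1) m \<noteq> 0" "\<And>i. ord_ge m (c i)" "\<And>i. i > i1 \<Longrightarrow> fls_nth (c i) m = 0"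
    by blast
  have "finite {j. \<not> ord_ge n (coeff f j)}" for n
    by (rule finite_subset[of _ "{..degree f}"]) (auto simp: ord_ge_iff intro: le_degree)
  from ex_dominant[OF this, of "degree f"] f obtain n j1 where
    n: "fls_nth (coeff f j1) n \<noteq> 0" "\<And>j. ord_ge n (coeff f j)" "\<And>j. j > j1 \<Longrightarrow> fls_nth (coeff f j) n = 0"
    by auto
  have j1: "j1 \<le> degree f" using n(1) by (auto intro: le_degree)
  have "fls_nth (act f c (i1 + int j1)) (n + m) =
      (\<Sum>j\<le>degree f. fls_nth (coeff f j) n * fls_nth (c (i1 + int j1 - int j)) m)"
    unfolding act_def fls_nth_sum using ord_ge_mult(2)[OF n(2) m(2)] by simp
  also have "\<dots> = (\<Sum>j\<le>degree f. if j = j1 then fls_nth (coeff f j1) n * fls_nth (c i1) m else 0)"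
  proof (rule sum.cong)
    fix j
    show "fls_nth (coeff f j) n * fls_nth (c (i1 + int j1 - int j)) m =
        (if j = j1 then fls_nth (coeff f j1) n * fls_nth (c i1) m else 0)"
      using n(3)[of j] m(3)[of "i1 + int j1 - int j"] by (cases j j1 rule: linorder_cases) auto
  qed simp
  also have "\<dots> = fls_nth (coeff f j1) n * fls_nth (c i1) m" using j1 by simp
  finally show False using m n eq by simp
qed

section \<open>One-sided annihilators are coprime\<close>

text \<open>
  The sequence \<open>s\<close> is a quotient \<open>P / w\<close> with a polynomial \<open>P\<close>, up to a shift. As \<open>s\<close> is not finite,
  \<open>w\<close> does not divide \<open>P\<close>, and because \<open>w\<close> has no proper nonconstant divisor the two are coprime.
  From \<open>1 = a * w + b * P\<close> one reads off an inverse \<open>a + b * s\<close> of \<open>w\<close>, which is finite on each side on which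
  \<open>s\<close> is.
\<close>

lemma inverse_from_quotient:
  fixes s :: "int \<Rightarrow> 'a::field fls"
  assumes s: "decays s" "\<not> (left_finite s \<and> right_finite s)"
    and ws: "left_finite (act w s)" "right_finite (act w s)"
    and w: "w \<noteq> 0" and min: "\<And>v. v dvd w \<Longrightarrow> degree v < degree w \<Longrightarrow> degree v = 0"
  shows "\<exists>a b k. \<forall>i. act w (\<lambda>i. act a delta i + act b (\<lambda>i. s (i - k)) i) i = delta i"
proof -
  obtain k P where P: "\<And>i. act w s (i - int k) = act P delta i"
    using finite_seq_poly[OF ws] by blast
  define s' where "s' i = s (i - int k)" for i
  have s': "decays s'" unfolding s'_def by (rule decays_shift[OF s(1)])
  have ws': "act w s' i = act P delta i" for i
    using P by (simp add: s'_def[abs_def] act_shift)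
  have ndvd: "\<not> w dvd P"
  proof
    assume "w dvd P"
    then obtain R where R: "P = w * R" by blast
    have "decays (\<lambda>i. s' i - act R delta i)"
      using decays_add[OF s' decays_mult[OF decays_act[OF decays_delta, of R], of "-1"]] by simp
    moreover have "act w (\<lambda>i. s' i - act R delta i) i = 0" for i
      using ws' by (simp add: act_diff R act_mult)
    ultimately have "s' i = act R delta i" for i
      using act_eq_0_imp_eq_0[OF _ w] by (metis right_minus_eq)
    then have "s' = act R delta" by auto
    then have "left_finite s'" "right_finite s'"
      using finite_delta left_finite_act right_finite_act by metis+
    then have "left_finite (\<lambda>i. s' (i - (- int k)))" "right_finite (\<lambda>i. s' (i - (- int k)))"
      using left_finite_shift right_finite_shift by blast+
    then show False using s(2) by (simp add: s'_def)
  qed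
  define J where "J = {a * w + b * P | a b. True}"
  have J: "f \<in> J \<longleftrightarrow> (\<exists>a b. f = a * w + b * P)" for f by (auto simp: J_def)
  have "w \<in> J" unfolding J by (rule exI[of _ 1], rule exI[of _ 0]) simp
  have "P \<in> J" unfolding J by (rule exI[of _ 0], rule exI[of _ 1]) simp
  have "\<exists>d\<in>J. lead_coeff d = 1 \<and> (\<forall>f\<in>J. d dvd f)"
  proof (rule ideal_generator[of UNIV _ w])
    fix f g :: "'a fls poly" and a n
    assume "f \<in> J" "g \<in> J"
    then obtain a1 b1 a2 b2 where "f = a1 * w + b1 * P" "g = a2 * w + b2 * P"
      unfolding J by blast
    then have "f - monom a n * g = (a1 - monom a n * a2) * w + (b1 - monom a n * b2) * P"
      by (simp add: algebra_simps)
    then show "f - monom a n * g \<in> J" unfolding J by blast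
  qed (use \<open>w \<in> J\<close> w in \<open>auto simp: is_subfield_def coeffs_in_def\<close>)
  then obtain d where d: "d \<in> J" "lead_coeff d = 1" "d dvd w" "d dvd P"
    using \<open>w \<in> J\<close> \<open>P \<in> J\<close> by blast
  have "degree d = 0"
  proof (rule ccontr)
    assume "degree d \<noteq> 0"
    then have "\<not> degree d < degree w" using min[OF d(3)] by auto
    obtain e where e: "w = d * e" using d(3) by blast
    then have "degree e = 0" "e \<noteq> 0" using \<open>\<not> degree d < degree w\<close> w
      by (auto simp: degree_mult_eq)
    then have "is_unit e" by (simp add: is_unit_iff_degree)
    then have "w dvd d" using e by (simp add: mult_unit_dvd_iff)
    then show False using d(4) ndvd dvd_trans by blast
  qed
  then have "d = 1" using d(2) by (auto elim!: degree_eq_zeroE simp: one_pCons)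
  then obtain a b where ab: "1 = a * w + b * P" using d(1) unfolding J by blast
  have "act w (\<lambda>i. act a delta i + act b s' i) i = delta i" for i
  proof -
    have "act w (\<lambda>i. act a delta i + act b s' i) i = act w (act a delta) i + act b (act w s') i"
      by (simp add: act_add act_commute[of w b])
    also have "act w s' = act P delta" using ws' by auto
    also have "act w (act a delta) i + act b (act P delta) i = act 1 delta i"
      unfolding ab act_add_poly act_mult by (simp add: act_commute[of w])
    finally show ?thesis by simp
  qed
  then show ?thesis unfolding s'_def by blast
qed

lemma dvd_monom_imp_degree_0:
  fixes w :: "'a::field poly"
  assumes "w dvd monom 1 k" "coeff w 0 \<noteq> 0" shows "degree w = 0"
  using assms(1)
proof (induction k)
  case 0
  then show ?case by (simp add: monom_0 one_pCons[symmetric] is_unit_iff_degree) (metis is_unit_iff_degree not_is_unit_0)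
next
  case (Suc k)
  then obtain R where R: "monom 1 (Suc k) = w * R" by blast
  have "coeff w 0 * coeff R 0 = 0" by (metis R coeff_mult_0 coeff_monom nat.distinct(1))
  then have "coeff R 0 = 0" using assms(2) by simp
  then obtain R' where "R = pCons 0 R'" by (metis coeff_pCons_0 pCons_cases)
  then have "pCons 0 (monom 1 k) = pCons 0 (w * R')" using R by (simp add: monom_Suc)
  then have "monom 1 k = w * R'" by simp
  then show ?case using Suc.IH by simp
qed

text \<open>
  Cutting a sequence off creates only finitely many new terms in its product with \<open>w\<close>.
\<close>

lemma annihilated_tail:
  fixes s :: "int \<Rightarrow> 'a::field fls"
  shows "right_finite (act w s) \<Longrightarrow>
    \<exists>N. right_finite (act w (\<lambda>i. if i > N then s i else 0))"
  and "left_finite (act w s) \<Longrightarrow>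
    \<exists>N. left_finite (act w (\<lambda>i. if i < N then s i else 0))"
proof -
  assume "right_finite (act w s)"
  then obtain N where N: "\<And>i. i > N \<Longrightarrow> act w s i = 0" by (auto simp: right_finite_def)
  have "act w (\<lambda>i. if i > N then s i else 0) i = act w s i" if "i > N + int (degree w)" for i
    unfolding act_def by (rule sum.cong) (use that in auto)
  then have "right_finite (act w (\<lambda>i. if i > N then s i else 0))"
    using N unfolding right_finite_def by (intro exI[of _ "N + int (degree w)"]) auto
  then show "\<exists>N. right_finite (act w (\<lambda>i. if i > N then s i else 0))" ..
next
  assume "left_finite (act w s)"
  then obtain N where N: "\<And>i. i < N \<Longrightarrow> act w s i = 0" by (auto simp: left_finite_def)
  have "act w (\<lambda>i. if i < N then s i else 0) i = act w s i" if "i < N" for i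
    unfolding act_def by (rule sum.cong) (use that in auto)
  then have "left_finite (act w (\<lambda>i. if i < N then s i else 0))"
    using N unfolding left_finite_def by (intro exI[of _ N]) auto
  then show "\<exists>N. left_finite (act w (\<lambda>i. if i < N then s i else 0))" ..
qed

text \<open>
  If \<open>w\<close> were nonconstant, the right tail of \<open>h1 * c\<close> would give an inverse of \<open>w\<close> that is finite on the left,
  and the left tail of \<open>h2 * c\<close> an inverse that is finite on the right. Decaying inverses are unique,
  so both agree and are a Laurent polynomial; hence \<open>w\<close> divides a power of \<open>x\<close>, which the
  nonzero constant coefficient excludes.
\<close>

lemma one_sided_annihilators_coprime:
  fixes c :: "int \<Rightarrow> 'a::field fls"
  assumes c: "decays c"
    and h: "\<not> right_finite (act h1 c)" "\<not> left_finite (act h2 c)"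
    and w: "right_finite (act w (act h1 c))" "left_finite (act w (act h2 c))"
    and min: "\<And>v. v dvd w \<Longrightarrow> degree v < degree w \<Longrightarrow> degree v = 0"
    and w0: "coeff w 0 \<noteq> 0"
  shows "degree w = 0"
proof -
  have wn: "w \<noteq> 0" using w0 by auto
  obtain N M where N: "right_finite (act w (\<lambda>i. if i > N then act h1 c i else 0))"
    and M: "left_finite (act w (\<lambda>i. if i < M then act h2 c i else 0))"
    using annihilated_tail(1)[OF w(1)] annihilated_tail(2)[OF w(2)] by blast
  define s where "s i = (if i > N then act h1 c i else 0)" for i
  define t where "t i = (if i < M then act h2 c i else 0)" for i
  have s: "decays s" "left_finite s" "right_finite (act w s)"
    and t: "decays t" "right_finite t" "left_finite (act w t)"
  proof -
    show "left_finite s" unfolding left_finite_def s_def by (rule exI[of _ N]) auto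
    show "right_finite t" unfolding right_finite_def t_def by (rule exI[of _ M]) auto
    show "decays s" "decays t" "right_finite (act w s)" "left_finite (act w t)"
      unfolding s_def[abs_def] t_def[abs_def] by (rule decays_restrict[OF decays_act[OF c]] N M)+
  qed
  have s': "\<not> right_finite s"
  proof
    assume "right_finite s"
    then obtain N' where "\<And>i. i > N' \<Longrightarrow> s i = 0" by (auto simp: right_finite_def)
    then have "act h1 c i = 0" if "i > max N N'" for i using that by (force simp: s_def)
    then show False using h(1) unfolding right_finite_def by blast
  qed
  have t': "\<not> left_finite t"
  proof
    assume "left_finite t"
    then obtain N' where "\<And>i. i < N' \<Longrightarrow> t i = 0" by (auto simp: left_finite_def)
    then have "act h2 c i = 0" if "i < min M N'" for i using that by (force simp: t_def)
    then show False using h(2) unfolding left_finite_def by blast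
  qed
  obtain a b k where S: "\<And>i. act w (\<lambda>i. act a delta i + act b (\<lambda>i. s (i - k)) i) i = delta i"
    using inverse_from_quotient[OF s(1) _ left_finite_act[OF s(2)] s(3) wn min] s' by blast
  obtain a' b' k' where T: "\<And>i. act w (\<lambda>i. act a' delta i + act b' (\<lambda>i. t (i - k')) i) i = delta i"
    using inverse_from_quotient[OF t(1) _ t(3) right_finite_act[OF t(2)] wn min] t' by blast
  \<comment> \<open>Two inverses of \<open>w\<close>, finite on opposite sides.\<close>
  define u where "u i = act a delta i + act b (\<lambda>i. s (i - k)) i" for i
  define v where "v i = act a' delta i + act b' (\<lambda>i. t (i - k')) i" for i
  have u: "decays u" "left_finite u" "\<And>i. act w u i = delta i"
    unfolding u_def[abs_def]
    by (rule S decays_add left_finite_add decays_act left_finite_act decays_delta finite_delta(2)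
      decays_shift left_finite_shift s(1) s(2))+
  have v: "decays v" "right_finite v" "\<And>i. act w v i = delta i"
    unfolding v_def[abs_def]
    by (rule T decays_add right_finite_add decays_act right_finite_act decays_delta finite_delta(1)
      decays_shift right_finite_shift t(1) t(2))+
  have "decays (\<lambda>i. u i - v i)"
    using decays_add[OF u(1) decays_mult[OF v(1), of "-1"]] by simp
  from act_eq_0_imp_eq_0[OF this wn] have "u i = v i" for i
    using u(3) v(3) by (simp add: act_diff)
  then have "u = v" by auto
  then obtain l R where R: "\<And>i. u (i - int l) = act R delta i"
    using finite_seq_poly[of u] u v by blast
  have "act (w * R) delta i = act (monom 1 l) delta i" for i
  proof -
    have "act R delta = (\<lambda>i. u (i - int l))" using R by auto
    then show ?thesis by (simp add: act_mult act_shift u(3) act_monom)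
  qed
  then have "w * R = monom 1 l" by (rule act_delta_inject)
  then show ?thesis using dvd_monom_imp_degree_0[of w l] w0 by (metis dvd_triv_left)
qed

section \<open>Decaying solutions of algebraic equations are algebraic\<close>

lemma solve_coefficient:
  fixes f :: "'a::field poly"
  assumes K: "is_subfield K" and f: "coeffs_in K f" "coeff f j0 \<noteq> 0"
    and act: "act f c (i + int j0) \<in> K"
    and other: "\<And>j. j \<noteq> j0 \<Longrightarrow> coeff f j \<noteq> 0 \<Longrightarrow> c (i + int j0 - int j) \<in> K"
  shows "c i \<in> K"
proof -
  note Ks = is_subfield_simps[OF K]
  define r where "r = (\<Sum>j\<in>{..degree f} - {j0}. coeff f j * c (i + int j0 - int j))"
  have "coeff f j * c (i + int j0 - int j) \<in> K" if "j \<noteq> j0" for j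
    using f(1) other[OF that] by (cases "coeff f j = 0") (auto simp: coeffs_in_def intro: Ks)
  then have r: "r \<in> K" unfolding r_def by (intro is_subfield_sum[OF K]) auto
  have "act f c (i + int j0) = coeff f j0 * c i + r"
    unfolding act_def r_def using f(2) by (subst sum.remove[of _ j0]) (auto intro: le_degree)
  then have "c i = (act f c (i + int j0) - r) / coeff f j0" using f(2) by simp
  then show ?thesis using act r f(1) by (metis Ks(3,5) coeffs_in_def)
qed

text \<open>
  A sequence that vanishes far out on one side is determined by its product with \<open>f\<close>: starting
  from the zeros, the extreme coefficient of \<open>f\<close> is used to solve for one term after the other.
\<close>

lemma one_sided_solution_in:
  fixes f :: "'a::field poly"
  assumes K: "is_subfield K" and f: "coeffs_in K f" "f \<noteq> 0"
    and act: "\<And>i. act f c i \<in> K" and fin: "right_finite c \<or> left_finite c"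
  shows "c i \<in> K"
  using fin
proof
  note Ks = is_subfield_simps[OF K]
  assume "right_finite c"
  then obtain N where N: "\<And>i. i > N \<Longrightarrow> c i = 0" by (auto simp: right_finite_def)
  show ?thesis
  proof (induction "nat (N + 1 - i)" arbitrary: i rule: less_induct)
    case less
    show ?case
    proof (cases "i > N")
      case False
      show ?thesis
      proof (rule solve_coefficient[OF K f(1), of "degree f"])
        fix j assume "j \<noteq> degree f" "coeff f j \<noteq> 0"
        then have "j < degree f" using le_degree le_neq_implies_less by blast
        then show "c (i + int (degree f) - int j) \<in> K" using less False by simp
      qed (use f act in auto)
    qed (use N Ks in auto)
  qed
next
  note Ks = is_subfield_simps[OF K]
  assume "left_finite c"
  then obtain N where N: "\<And>i. i < N \<Longrightarrow> c i = 0" by (auto simp: left_finite_def)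
  define j0 where "j0 = (LEAST j. coeff f j \<noteq> 0)"
  have "coeff f (degree f) \<noteq> 0" using f(2) by simp
  then have j0: "coeff f j0 \<noteq> 0" unfolding j0_def by (rule LeastI)
  show ?thesis
  proof (induction "nat (i + 1 - N)" arbitrary: i rule: less_induct)
    case less
    show ?case
    proof (cases "i < N")
      case False
      show ?thesis
      proof (rule solve_coefficient[OF K f(1) j0 act])
        fix j assume "j \<noteq> j0" "coeff f j \<noteq> 0"
        then have "j0 < j" unfolding j0_def by (metis Least_le le_neq_implies_less)
        then show "c (i + int j0 - int j) \<in> K" using less False by simp
      qed
    qed (use N Ks in auto)
  qed
qed

lemma act_monom_mult_diff: "act (f - monom a n * g) c i = act f c i - a * act g c (i - int n)"
  by (simp add: act_diff_poly act_mult act_monom)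

text \<open>
  The predicate \<open>Z\<close> is \<open>left_finite\<close> or \<open>right_finite\<close>. The polynomials whose product with \<open>c\<close> is finite
  on the given side form an ideal, and its generator is prime to \<open>x\<close> because a shift does not
  affect finiteness.
\<close>

lemma ex_minimal_annihilator:
  fixes c :: "int \<Rightarrow> 'a::field fls"
  assumes Z: "Z (\<lambda>i. 0)" "\<And>c d. Z c \<Longrightarrow> Z d \<Longrightarrow> Z (\<lambda>i. c i + d i)" "\<And>f c. Z c \<Longrightarrow> Z (act f c)"
      "\<And>c k. Z c \<Longrightarrow> Z (\<lambda>i. c (i - k))"
    and Q: "Q \<noteq> 0" "Z (act Q c)"
  shows "\<exists>U. lead_coeff U = 1 \<and> Z (act U c) \<and> (\<forall>f. Z (act f c) \<longrightarrow> U dvd f) \<and> coeff U 0 \<noteq> 0"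
proof -
  define J where "J = {f. Z (act f c)}"
  have "\<exists>d\<in>J. lead_coeff d = 1 \<and> (\<forall>f\<in>J. d dvd f)"
  proof (rule ideal_generator[of UNIV _ Q])
    fix f g :: "'a fls poly" and a n
    assume "f \<in> J" "g \<in> J"
    then have "Z (\<lambda>i. act f c i + act (monom (- a) n) (act g c) i)"
      unfolding J_def using Z by blast
    then show "f - monom a n * g \<in> J"
      by (simp add: J_def act_monom_mult_diff[abs_def] act_monom fun_eq_iff[symmetric])
  qed (use Q in \<open>auto simp: J_def is_subfield_def coeffs_in_def\<close>)
  then obtain U where U: "lead_coeff U = 1" "Z (act U c)" "\<And>f. Z (act f c) \<Longrightarrow> U dvd f"
    by (auto simp: J_def)
  have "coeff U 0 \<noteq> 0"
  proof
    assume "coeff U 0 = 0"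
    then obtain V where V: "U = pCons 0 V" by (metis coeff_pCons_0 pCons_cases)
    then have "act V c = (\<lambda>i. act U c (i - (- 1)))" by (simp add: act_pCons)
    then have "Z (act V c)" using Z(4)[OF U(2)] by metis
    then have "U dvd V" by (rule U(3))
    moreover have "V \<noteq> 0" using U(1) V by auto
    ultimately have "degree U \<le> degree V" by (rule dvd_imp_degree_le)
    then show False using V \<open>V \<noteq> 0\<close> by simp
  qed
  then show ?thesis using U by blast
qed

text \<open>
  Algebraically, \<open>c\<close> is an expansion of the rational function \<open>P / Q\<close>, and its terms are sums of
  residues at 0 and at those roots of \<open>Q\<close> that are small in the adic valuation. The proof
  separates small and large roots without leaving the field of Laurent series: \<open>U\<close>, the least
  polynomial whose product with \<open>c\<close> is finite on the right, and \<open>V\<close>, its counterpart on the left, are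
  divisors of \<open>Q\<close> and so have algebraic coefficients. Both \<open>U * c\<close> and \<open>V * c\<close> are one-sided solutions of
  equations over the algebraic elements and so consist of algebraic elements; as \<open>U\<close> and \<open>V\<close>
  are coprime, so does \<open>c\<close>.
\<close>

theorem decaying_solution_algebraic:
  fixes c :: "int \<Rightarrow> 'a::field fls"
  assumes K: "is_subfield K" and Q: "Q \<noteq> 0" "coeffs_in K Q" and c: "decays c"
    and P: "\<And>i. act Q c i \<in> K" "left_finite (act Q c)" "right_finite (act Q c)"
  shows "c i \<in> algebraics K"
proof -
  let ?A = "algebraics K"
  note A = is_subfield_algebraics(1)[OF K]
  note KA = is_subfield_algebraics(2)[OF K]
  note As = is_subfield_simps[OF A]
  have QA: "coeffs_in ?A Q" using Q KA by (auto simp: coeffs_in_def)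
  have z: "right_finite (\<lambda>i. 0 :: 'a fls)" "left_finite (\<lambda>i. 0 :: 'a fls)"
    by (auto simp: right_finite_def left_finite_def)
  obtain U where U: "lead_coeff U = 1" "right_finite (act U c)" "coeff U 0 \<noteq> 0"
      "\<And>f. right_finite (act f c) \<Longrightarrow> U dvd f"
    using ex_minimal_annihilator[of right_finite Q c, OF z(1) right_finite_add right_finite_act right_finite_shift Q(1) P(3)]
    by metis
  obtain V where V: "lead_coeff V = 1" "left_finite (act V c)" "coeff V 0 \<noteq> 0"
      "\<And>f. left_finite (act f c) \<Longrightarrow> V dvd f"
    using ex_minimal_annihilator[of left_finite Q c, OF z(2) left_finite_add left_finite_act left_finite_shift Q(1) P(2)]
    by metis
  have UV: "coeffs_in ?A U" "coeffs_in ?A V"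
    using coeffs_in_divisor[OF K Q(2,1)] U V P by auto
  have act_in: "act f (act Q c) i \<in> ?A" if "coeffs_in ?A f" for f i
    unfolding act_def[of f] using that P(1) KA
    by (intro is_subfield_sum[OF A] As(4)) (auto simp: coeffs_in_def)
  have e: "act U c i \<in> ?A" "act V c i \<in> ?A" for i
  proof -
    show "act U c i \<in> ?A"
      by (rule one_sided_solution_in[OF A QA Q(1)])
        (use act_in[OF UV(1)] U(2) in \<open>simp_all add: act_commute[of Q]\<close>)
    show "act V c i \<in> ?A"
      by (rule one_sided_solution_in[OF A QA Q(1)])
        (use act_in[OF UV(2)] V(2) in \<open>simp_all add: act_commute[of Q]\<close>)
  qed
  \<comment> \<open>The multipliers that turn \<open>c\<close> into a sequence of algebraic elements; the goal is \<open>1 \<in> J\<close>.\<close>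
  define J where "J = {f. coeffs_in ?A f \<and> (\<forall>i. act f c i \<in> ?A)}"
  have "\<exists>d\<in>J. lead_coeff d = 1 \<and> (\<forall>f\<in>J. d dvd f)"
  proof (rule ideal_generator[OF A, of _ U])
    fix f g :: "'a fls poly" and a n
    assume fg: "f \<in> J" "g \<in> J" and a: "a \<in> ?A"
    have "coeffs_in ?A (f - monom a n * g)"
      using fg a by (auto simp: J_def coeffs_in_def coeff_monom_mult intro!: As)
    then show "f - monom a n * g \<in> J"
      using fg a by (auto simp: J_def act_monom_mult_diff intro!: As)
  qed (use U UV e in \<open>auto simp: J_def\<close>)
  then obtain d where d: "d \<in> J" "lead_coeff d = 1" "d dvd U" "d dvd V"
    using UV e by (auto simp: J_def)
  have "degree d = 0"
  proof (rule ccontr)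
    assume "degree d \<noteq> 0"
    \<comment> \<open>A nonconstant divisor of least degree serves as an irreducible factor.\<close>
    then obtain w where w: "w dvd d" "degree w \<noteq> 0"
        and wmin: "\<And>v. v dvd d \<Longrightarrow> degree v \<noteq> 0 \<Longrightarrow> degree w \<le> degree v"
      using ex_has_least_nat[of "\<lambda>w. w dvd d \<and> degree w \<noteq> 0" d degree] by auto
    have min: "degree v = 0" if "v dvd w" "degree v < degree w" for v
      using wmin[of v] that w(1) dvd_trans by fastforce
    obtain h1 h2 where h: "U = w * h1" "V = w * h2"
      using w(1) d(3,4) by (meson dvd_def dvd_trans)
    have nz: "U \<noteq> 0" "V \<noteq> 0" using U(1) V(1) by auto
    then have "w \<noteq> 0" "h1 \<noteq> 0" "h2 \<noteq> 0" using h by auto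
    then have "\<not> U dvd h1" "\<not> V dvd h2"
      using w(2) h by (auto dest!: dvd_imp_degree_le simp: degree_mult_eq)
    then have "\<not> right_finite (act h1 c)" "\<not> left_finite (act h2 c)"
      using U(4) V(4) by blast+
    moreover have "act w (act h1 c) = act U c" "act w (act h2 c) = act V c"
      by (auto simp: h act_mult)
    moreover have "coeff w 0 \<noteq> 0" using U(3) h by (auto simp: coeff_mult_0)
    ultimately have "degree w = 0"
      using one_sided_annihilators_coprime[OF c, of h1 h2 w] U(2) V(2) min by simp
    then show False using w(2) by simp
  qed
  then have "d = 1" using d(2) by (auto elim!: degree_eq_zeroE simp: one_pCons)
  then show ?thesis using d(1) by (simp add: J_def)
qed

section \<open>The state of a vertex set at the labelled vertices\<close>

type_synonym state = "nat set \<times> (nat \<times> nat) set \<times> nat set \<times> nat set \<times> bool"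

text \<open>
  What later operations can see of a vertex set \<open>S\<close>: the labels in use, the edges between labelled
  vertices, the labels of vertices in \<open>S\<close>, the labels of vertices that have an unlabelled
  neighbour in \<open>S\<close>, and whether every unlabelled vertex is dominated. Edges between labelled vertices
  have to be remembered, because they may still be deleted; an edge with an unlabelled end is
  permanent, so that the domination of an unlabelled vertex never changes again.
\<close>

definition state_of :: "(nat \<rightharpoonup> nat) \<Rightarrow> nat set set \<Rightarrow> nat set \<Rightarrow> nat set \<Rightarrow> state" where
  "state_of m E V S =
     (dom m,
      {(i, j). \<exists>u v. m i = Some u \<and> m j = Some v \<and> {u, v} \<in> E},
      {i. \<exists>u\<in>S. m i = Some u},
      {i. \<exists>v. m i = Some v \<and> (\<exists>u\<in>S - ran m. {u, v} \<in> E)},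
      \<forall>v\<in>V - ran m. v \<in> S \<or> (\<exists>u\<in>S. {u, v} \<in> E))"

abbreviation lstate :: "nat lgraph \<Rightarrow> nat set \<Rightarrow> state" where
  "lstate L \<equiv> state_of (vertex_of L) (edges L) (verts L)"

text \<open>
  When a vertex loses its label, it passes on its contribution to its labelled neighbours, and
  its own domination is settled. If the label is absent, there is nothing to do.
\<close>

fun forget_label :: "nat \<Rightarrow> state \<Rightarrow> state" where
  "forget_label i (D, E, A, B, ok) =
     (if i \<in> D then
       (D - {i}, {(a, b) \<in> E. a \<noteq> i \<and> b \<noteq> i}, A - {i},
        {j \<in> D - {i}. j \<in> B \<or> i \<in> A \<and> (i, j) \<in> E},
        ok \<and> (i \<in> A \<or> i \<in> B \<or> (\<exists>j\<in>A. (j, i) \<in> E)))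
      else (D, E, A, B, ok))"

text \<open>
  Used only after \<open>j\<close> has been freed. The function \<open>g\<close> sends a new label to the old one, so that every
  component becomes a preimage.
\<close>

fun move_label :: "nat \<Rightarrow> nat \<Rightarrow> state \<Rightarrow> state" where
  "move_label i j (D, E, A, B, ok) =
     (let g = (\<lambda>a. if a = j then i else a)
      in ({a. a \<noteq> i \<and> g a \<in> D}, {(a, b). a \<noteq> i \<and> b \<noteq> i \<and> (g a, g b) \<in> E},
          {a. a \<noteq> i \<and> g a \<in> A}, {a. a \<noteq> i \<and> g a \<in> B}, ok))"

text \<open>
  The effect of an operation on the state of a fixed vertex set. For a new vertex this is the case
  in which the set does not contain it; \<open>select_label\<close> below gives the other case.
\<close>

fun state_op :: "elem_op \<Rightarrow> state \<Rightarrow> state" where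
  "state_op (Add_Vertex i) s =
     (let (D, E, A, B, ok) = forget_label i s in (insert i D, E, A, B, ok))"
| "state_op (Change_Label i j) s =
     (if i \<in> fst s \<and> i \<noteq> j then move_label i j (forget_label j s) else s)"
| "state_op (Remove_Label i) s = forget_label i s"
| "state_op (Add_Edge i j) s =
     (let (D, E, A, B, ok) = s
      in if i \<in> D \<and> j \<in> D then (D, E \<union> {(i, j), (j, i)}, A, B, ok) else s)"
| "state_op (Delete_Edge i j) s =
     (let (D, E, A, B, ok) = s
      in if i \<in> D \<and> j \<in> D then (D, E - {(i, j), (j, i)}, A, B, ok) else s)"

fun select_label :: "nat \<Rightarrow> state \<Rightarrow> state" where
  "select_label i (D, E, A, B, ok) = (D, E, insert i A, B, ok)"

fun accepting :: "state \<Rightarrow> bool" where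
  "accepting (D, E, A, B, ok) \<longleftrightarrow>
     ok \<and> (\<forall>i\<in>D. i \<in> A \<or> i \<in> B \<or> (\<exists>j\<in>A. (j, i) \<in> E))"

lemma state_of_forget:
  assumes inj: "\<And>a b v. m a = Some v \<Longrightarrow> m b = Some v \<Longrightarrow> a = b" and V: "ran m \<subseteq> V"
  shows "state_of (m(i := None)) E V S = forget_label i (state_of m E V S)"
proof (cases "m i")
  case None
  then have "m(i := None) = m" by auto
  then show ?thesis using None by (auto simp: state_of_def)
next
  case (Some w)
  have ran: "ran (m(i := None)) = ran m - {w}"
  proof (intro Set.set_eqI iffI)
    fix x assume "x \<in> ran (m(i := None))"
    then obtain a where "a \<noteq> i" "m a = Some x" by (auto simp: ran_def split: if_splits)
    then show "x \<in> ran m - {w}" using Some inj by (auto intro: ranI)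
  next
    fix x assume "x \<in> ran m - {w}"
    then obtain a where "m a = Some x" "x \<noteq> w" by (auto simp: ran_def)
    then show "x \<in> ran (m(i := None))" using Some by (intro ranI[of _ a]) auto
  qed
  have wr: "w \<in> ran m" "w \<in> V" using Some V by (auto simp: ran_def)
  have 1: "{a. \<exists>u\<in>S. (m(i := None)) a = Some u} = {a. \<exists>u\<in>S. m a = Some u} - {i}" by auto
  have iA: "(\<exists>u\<in>S. m i = Some u) \<longleftrightarrow> w \<in> S" using Some by auto
  have 2: "{a. \<exists>v. (m(i := None)) a = Some v \<and> (\<exists>u\<in>S - (ran m - {w}). {u, v} \<in> E)} =
      {j \<in> dom m - {i}. (\<exists>v. m j = Some v \<and> (\<exists>u\<in>S - ran m. {u, v} \<in> E)) \<or>
         w \<in> S \<and> (\<exists>u v. m i = Some u \<and> m j = Some v \<and> {u, v} \<in> E)}"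
    using Some wr by (auto simp: dom_def)
  have 3: "(\<forall>v\<in>V - (ran m - {w}). v \<in> S \<or> (\<exists>u\<in>S. {u, v} \<in> E)) \<longleftrightarrow>
     (\<forall>v\<in>V - ran m. v \<in> S \<or> (\<exists>u\<in>S. {u, v} \<in> E)) \<and>
     (w \<in> S \<or> (\<exists>u\<in>S - ran m. {u, w} \<in> E) \<or> (\<exists>j. (\<exists>u\<in>S. m j = Some u \<and> {u, w} \<in> E)))"
  proof -
    have "V - (ran m - {w}) = insert w (V - ran m)" using wr by auto
    moreover have "(\<exists>u\<in>S. {u, w} \<in> E) \<longleftrightarrow>
        (\<exists>u\<in>S - ran m. {u, w} \<in> E) \<or> (\<exists>j. \<exists>u\<in>S. m j = Some u \<and> {u, w} \<in> E)"
      unfolding ran_def by blast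
    ultimately show ?thesis by (simp only: ball_simps) blast
  qed
  have 4: "{(a, b). \<exists>u v. (m(i := None)) a = Some u \<and> (m(i := None)) b = Some v \<and> {u, v} \<in> E} =
     {(a, b) \<in> {(a, b). \<exists>u v. m a = Some u \<and> m b = Some v \<and> {u, v} \<in> E}. a \<noteq> i \<and> b \<noteq> i}"
    by auto
  have 5: "(\<exists>j\<in>{a. \<exists>u\<in>S. m a = Some u}. (j, i) \<in> {(a, b). \<exists>u v. m a = Some u \<and> m b = Some v \<and> {u, v} \<in> E})
     \<longleftrightarrow> (\<exists>j. (\<exists>u\<in>S. m j = Some u \<and> {u, w} \<in> E))" by (simp add: Some) (metis option.inject)
  have 6: "i \<in> {a. \<exists>v. m a = Some v \<and> (\<exists>u\<in>S - ran m. {u, v} \<in> E)} \<longleftrightarrow> (\<exists>u\<in>S - ran m. {u, w} \<in> E)"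
    using Some by auto
  have 7: "i \<in> dom m" using Some by auto
  show ?thesis
    unfolding state_of_def forget_label.simps ran 1 2 3 4 5 6 if_P[OF 7] using iA by simp
qed

lemma state_of_move:
  assumes "m i = Some v" "m j = None" "i \<noteq> j"
  shows "state_of (m(i := None, j := Some v)) E V S = move_label i j (state_of m E V S)"
proof -
  define g where "g a = (if a = j then i else a)" for a
  have m': "(m(i := None, j := Some v)) a = (if a = i then None else m (g a))" for a
    using assms by (auto simp: g_def)
  have "ran (m(i := None, j := Some v)) = ran m"
  proof (intro Set.set_eqI iffI)
    fix x assume "x \<in> ran (m(i := None, j := Some v))"
    then show "x \<in> ran m" unfolding ran_def m' by (auto split: if_splits)
  next
    fix x assume "x \<in> ran m"
    then obtain a where a: "m a = Some x" by (auto simp: ran_def)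
    show "x \<in> ran (m(i := None, j := Some v))"
      using a assms ranI[of "m(i := None, j := Some v)" j x] ranI[of "m(i := None, j := Some v)" a x]
      by (cases "a = i"; cases "a = j") auto
  qed
  moreover define m' where "m' = m(i := None, j := Some v)"
  ultimately have ran: "ran m' = ran m" by simp
  have k: "m' a = Some u \<longleftrightarrow> a \<noteq> i \<and> m (g a) = Some u" for a u
    unfolding m'_def m' by simp
  have dom: "dom m' = {a. a \<noteq> i \<and> g a \<in> dom m}"
    unfolding dom_def m'_def m' by auto
  have g: "(if a = j then i else a) = g a" for a by (simp add: g_def)
  show ?thesis
    unfolding m'_def[symmetric] state_of_def move_label.simps Let_def g ran dom k prod.inject
    by (intro conjI) auto
qed

text \<open>
  A new vertex has no neighbours, so it affects neither the domination of the other vertices nor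
  the labels with an unlabelled neighbour in the set.
\<close>

lemma state_of_fresh:
  assumes "m i = None" "v \<notin> V" "ran m \<subseteq> V" "\<And>e. e \<in> E \<Longrightarrow> e \<subseteq> V" "S \<subseteq> V"
  shows "state_of (m(i := Some v)) E (insert v V) S =
      (let (D, E, A, B, ok) = state_of m E V S in (insert i D, E, A, B, ok))"
    and "state_of (m(i := Some v)) E (insert v V) (insert v S) =
      select_label i (let (D, E, A, B, ok) = state_of m E V S in (insert i D, E, A, B, ok))"
proof -
  have ran: "ran (m(i := Some v)) = insert v (ran m)"
    using assms(1) by (rule ran_map_upd)
  have v: "v \<notin> ran m" "v \<notin> S" "\<And>u. {u, v} \<notin> E" "\<And>u. {v, u} \<notin> E" using assms by auto
  have u: "m j \<noteq> Some v" for j using v(1) by (auto simp: ran_def)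
  have 0: "insert v V - insert v (ran m) = V - ran m" "insert v S - insert v (ran m) = S - ran m"
    "S - insert v (ran m) = S - ran m"
    using v assms by auto
  have ok: "(\<forall>w\<in>V - ran m. w \<in> insert v S \<or> (\<exists>u\<in>insert v S. {u, w} \<in> E)) \<longleftrightarrow>
      (\<forall>w\<in>V - ran m. w \<in> S \<or> (\<exists>u\<in>S. {u, w} \<in> E))"
    by (intro ball_cong refl) (use v assms(2) in auto)
  show "state_of (m(i := Some v)) E (insert v V) S =
      (let (D, E, A, B, ok) = state_of m E V S in (insert i D, E, A, B, ok))"
    "state_of (m(i := Some v)) E (insert v V) (insert v S) =
      select_label i (let (D, E, A, B, ok) = state_of m E V S in (insert i D, E, A, B, ok))"
    unfolding state_of_def Let_def prod.case select_label.simps ran 0 ok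
    using v assms(1,2) u by (auto split: if_splits)
qed

text \<open>
  Injectivity of the labelling makes the labels of the two ends the only ones affected, and
  no edge with an unlabelled end is touched.
\<close>

lemma state_of_edge:
  assumes inj: "\<And>a b v. m a = Some v \<Longrightarrow> m b = Some v \<Longrightarrow> a = b"
    and m: "m i = Some u" "m j = Some v"
  shows "state_of m (insert {u, v} E) V S =
      (let (D, E, A, B, ok) = state_of m E V S in (D, E \<union> {(i, j), (j, i)}, A, B, ok))"
    and "state_of m (E - {{u, v}}) V S =
      (let (D, E, A, B, ok) = state_of m E V S in (D, E - {(i, j), (j, i)}, A, B, ok))"
proof -
  have r: "u \<in> ran m" "v \<in> ran m" using m by (auto simp: ran_def)
  have e: "{x, y} = {u, v} \<longleftrightarrow> (a, b) \<in> {(i, j), (j, i)}" if "m a = Some x" "m b = Some y" for a b x y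
    using that m inj by (auto simp: doubleton_eq_iff)
  have n: "{x, y} \<noteq> {u, v}" if "x \<notin> ran m \<or> y \<notin> ran m" for x y
    using that r by (auto simp: doubleton_eq_iff)
  have 1: "{(a, b). \<exists>x y. m a = Some x \<and> m b = Some y \<and> {x, y} \<in> insert {u, v} E} =
     {(a, b). \<exists>x y. m a = Some x \<and> m b = Some y \<and> {x, y} \<in> E} \<union> {(i, j), (j, i)}" (is "?L = ?R")
  proof (intro Set.set_eqI)
    fix p :: "nat \<times> nat"
    obtain a b where p: "p = (a, b)" by (cases p)
    show "p \<in> ?L \<longleftrightarrow> p \<in> ?R"
      unfolding p insert_iff using e[of a _ b] m by auto
  qed
  have 2: "{(a, b). \<exists>x y. m a = Some x \<and> m b = Some y \<and> {x, y} \<in> E - {{u, v}}} =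
     {(a, b). \<exists>x y. m a = Some x \<and> m b = Some y \<and> {x, y} \<in> E} - {(i, j), (j, i)}" (is "?L = ?R")
  proof (intro Set.set_eqI)
    fix p :: "nat \<times> nat"
    obtain a b where p: "p = (a, b)" by (cases p)
    show "p \<in> ?L \<longleftrightarrow> p \<in> ?R"
      unfolding p Diff_iff singleton_iff using e[of a _ b] m by auto
  qed
  have 3: "(\<exists>x\<in>S - ran m. {x, y} \<in> insert {u, v} E) \<longleftrightarrow> (\<exists>x\<in>S - ran m. {x, y} \<in> E)"
     "(\<exists>x\<in>S - ran m. {x, y} \<in> E - {{u, v}}) \<longleftrightarrow> (\<exists>x\<in>S - ran m. {x, y} \<in> E)" for y
    using n by auto
  have 4: "(\<forall>y\<in>V - ran m. y \<in> S \<or> (\<exists>x\<in>S. {x, y} \<in> insert {u, v} E)) \<longleftrightarrow>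
      (\<forall>y\<in>V - ran m. y \<in> S \<or> (\<exists>x\<in>S. {x, y} \<in> E))"
     "(\<forall>y\<in>V - ran m. y \<in> S \<or> (\<exists>x\<in>S. {x, y} \<in> E - {{u, v}})) \<longleftrightarrow>
      (\<forall>y\<in>V - ran m. y \<in> S \<or> (\<exists>x\<in>S. {x, y} \<in> E))"
    using n by auto
  show "state_of m (insert {u, v} E) V S =
      (let (D, E, A, B, ok) = state_of m E V S in (D, E \<union> {(i, j), (j, i)}, A, B, ok))"
    unfolding state_of_def Let_def prod.case 1 3 4 ..
  show "state_of m (E - {{u, v}}) V S =
      (let (D, E, A, B, ok) = state_of m E V S in (D, E - {(i, j), (j, i)}, A, B, ok))"
    unfolding state_of_def Let_def prod.case 2 3 4 ..
qed

lemma labelled_graphD: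
  assumes "labelled_graph k L"
  shows "finite (verts L)" "\<And>e. e \<in> edges L \<Longrightarrow> e \<subseteq> verts L" "ran (vertex_of L) \<subseteq> verts L"
    "\<And>a b v. vertex_of L a = Some v \<Longrightarrow> vertex_of L b = Some v \<Longrightarrow> a = b"
    "\<And>a v. vertex_of L a = Some v \<Longrightarrow> a \<in> {1..k}"
  using assms unfolding labelled_graph_def simple_graph_def
  by (fastforce simp: inj_on_def ran_def dom_def)+

lemma labelled_graphI:
  assumes "finite (verts L)" "\<And>e. e \<in> edges L \<Longrightarrow> \<exists>u\<in>verts L. \<exists>v\<in>verts L. u \<noteq> v \<and> e = {u, v}"
    "\<And>a v. vertex_of L a = Some v \<Longrightarrow> v \<in> verts L"
    "\<And>a b v. vertex_of L a = Some v \<Longrightarrow> vertex_of L b = Some v \<Longrightarrow> a = b"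
    "\<And>a v. vertex_of L a = Some v \<Longrightarrow> a \<in> {1..k}"
  shows "labelled_graph k L"
  using assms unfolding labelled_graph_def simple_graph_def
  by (auto simp: ran_def dom_def intro!: inj_onI)

lemma labelled_graph_edgeD:
  assumes "labelled_graph k L" "e \<in> edges L"
  shows "\<exists>u\<in>verts L. \<exists>v\<in>verts L. u \<noteq> v \<and> e = {u, v}"
  using assms by (auto simp: labelled_graph_def simple_graph_def)

lemma least_unused:
  assumes "finite V" shows "(LEAST v::nat. v \<notin> V) \<notin> V"
  by (rule LeastI_ex) (use ex_new_if_finite[OF infinite_UNIV_nat assms] in auto)

lemma labelled_graph_apply_op:
  assumes L: "labelled_graph k L" and p: "valid_op k p"
  shows "labelled_graph k (apply_op p L)"
proof -
  note D = labelled_graphD[OF L] labelled_graph_edgeD[OF L]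
  have V: "vertex_of L a = Some v \<Longrightarrow> v \<in> verts L" for a v using D(3) by (auto simp: ran_def)
  show ?thesis
  proof (cases p)
    case (Add_Vertex i)
    obtain v where v: "v = (LEAST v. v \<notin> verts L)" "v \<notin> verts L"
      using least_unused[OF D(1)] by blast
    have n: "vertex_of L a \<noteq> Some v" for a using V v(2) by blast
    have "labelled_graph k (L\<lparr>verts := insert v (verts L), vertex_of := (vertex_of L)(i \<mapsto> v)\<rparr>)"
    proof (rule labelled_graphI, goal_cases)
      case (2 e)
      then show ?case using D(6)[of e] by auto
    qed (use Add_Vertex p D(1,4,5) V n in \<open>auto split: if_splits\<close>)
    then show ?thesis by (simp add: Add_Vertex Let_def v(1))
  next
    case (Change_Label i j)
    show ?thesis
    proof (cases "vertex_of L i")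
      case (Some v)
      show ?thesis
        unfolding Change_Label apply_op.simps Some option.case
        by (rule labelled_graphI) (use Change_Label p D V Some in \<open>auto split: if_splits\<close>)
    qed (use L Change_Label in simp)
  next
    case (Remove_Label i)
    show ?thesis
      unfolding Remove_Label apply_op.simps
      by (rule labelled_graphI) (use D V in \<open>auto split: if_splits\<close>)
  next
    case (Add_Edge i j)
    show ?thesis
    proof (cases "vertex_of L i = None \<or> vertex_of L j = None")
      case False
      then obtain u v where uv: "vertex_of L i = Some u" "vertex_of L j = Some v" by auto
      have "u \<noteq> v" using D(4)[of i u j] uv p Add_Edge by auto
      then have "labelled_graph k (L\<lparr>edges := insert {u, v} (edges L)\<rparr>)"
      proof (intro labelled_graphI, goal_cases)
        case (2 e)
        then show ?case using D(6)[of e] V[OF uv(1)] V[OF uv(2)] \<open>u \<noteq> v\<close> by auto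
      qed (use D V in auto)
      then show ?thesis using uv Add_Edge by simp
    qed (use L Add_Edge in \<open>auto split: option.splits\<close>)
  next
    case (Delete_Edge i j)
    have "labelled_graph k (L\<lparr>edges := edges L - {{u, v}}\<rparr>)" for u v
      by (intro labelled_graphI) (use D V in auto)
    then show ?thesis using L Delete_Edge by (auto split: option.splits)
  qed
qed

lemma verts_apply_op:
  "verts (apply_op p L) =
    (case p of Add_Vertex i \<Rightarrow> insert (LEAST v. v \<notin> verts L) (verts L) | _ \<Rightarrow> verts L)"
  by (cases p) (auto simp: Let_def split: option.split)

lemma lstate_apply_op:
  assumes L: "labelled_graph k L" and S: "S \<subseteq> verts L" and p: "valid_op k p"
  shows "lstate (apply_op p L) S = state_op p (lstate L S)"
    and "p = Add_Vertex i \<Longrightarrow> lstate (apply_op p L) (insert (LEAST v. v \<notin> verts L) S) =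
      select_label i (state_op p (lstate L S))"
proof -
  note D = labelled_graphD[OF L]
  note forget = state_of_forget[OF D(4,3)]
  have add: "lstate (apply_op (Add_Vertex i) L) S = state_op (Add_Vertex i) (lstate L S)"
      "lstate (apply_op (Add_Vertex i) L) (insert (LEAST v. v \<notin> verts L) S) =
      select_label i (state_op (Add_Vertex i) (lstate L S))" for i
  proof -
    let ?v = "LEAST v. v \<notin> verts L" and ?m = "(vertex_of L)(i := None)"
    have "?v \<notin> verts L" by (rule least_unused[OF D(1)])
    moreover have "ran ?m \<subseteq> verts L" using D(3) by (auto simp: ran_def)
    moreover have m: "(vertex_of L)(i \<mapsto> ?v) = ?m(i \<mapsto> ?v)" by simp
    ultimately show "lstate (apply_op (Add_Vertex i) L) S = state_op (Add_Vertex i) (lstate L S)"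
      "lstate (apply_op (Add_Vertex i) L) (insert (LEAST v. v \<notin> verts L) S) =
        select_label i (state_op (Add_Vertex i) (lstate L S))"
      using state_of_fresh[where m = ?m and i = i and v = ?v and V = "verts L" and E = "edges L" and S = S] D(2) S
      by (simp_all add: Let_def forget)
  qed
  then show "p = Add_Vertex i \<Longrightarrow> lstate (apply_op p L) (insert (LEAST v. v \<notin> verts L) S) =
      select_label i (state_op p (lstate L S))" by simp
  have dom: "fst (lstate L S) = dom (vertex_of L)" by (simp add: state_of_def)
  show "lstate (apply_op p L) S = state_op p (lstate L S)"
  proof (cases p)
    case (Add_Vertex i)
    then show ?thesis using add by simp
  next
    case (Change_Label i j)
    show ?thesis
    proof (cases "vertex_of L i")
      case None
      then show ?thesis by (simp add: Change_Label dom domIff)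
    next
      case (Some v)
      show ?thesis
      proof (cases "i = j")
        case True
        then have "(vertex_of L)(i := None, j := Some v) = vertex_of L" using Some by auto
        then show ?thesis using True Some by (simp add: Change_Label)
      next
        case False
        let ?m = "(vertex_of L)(j := None)"
        have "(vertex_of L)(i := None, j := Some v) = ?m(i := None, j := Some v)" by auto
        then show ?thesis
          using False Some state_of_move[where m = ?m and i = i and v = v and j = j and V = "verts L" and E = "edges L" and S = S]
          by (simp add: Change_Label dom domIff forget)
      qed
    qed
  next
    case (Remove_Label i)
    then show ?thesis by (simp add: forget)
  next
    case (Add_Edge i j)
    show ?thesis
    proof (cases "vertex_of L i = None \<or> vertex_of L j = None")
      case False
      then obtain u v where uv: "vertex_of L i = Some u" "vertex_of L j = Some v" by auto
      then show ?thesis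
        using state_of_edge(1)[OF D(4) uv, where E = "edges L" and V = "verts L" and S = S]
        by (auto simp: Add_Edge state_of_def Let_def)
    qed (auto simp: Add_Edge state_of_def split: option.splits)
  next
    case (Delete_Edge i j)
    show ?thesis
    proof (cases "vertex_of L i = None \<or> vertex_of L j = None")
      case False
      then obtain u v where uv: "vertex_of L i = Some u" "vertex_of L j = Some v" by auto
      then show ?thesis
        using state_of_edge(2)[OF D(4) uv, where E = "edges L" and V = "verts L" and S = S]
        by (auto simp: Delete_Edge state_of_def Let_def)
    qed (auto simp: Delete_Edge state_of_def split: option.splits)
  qed
qed

lemma dominating_iff_accepting:
  assumes "labelled_graph k L" "S \<subseteq> verts L"
  shows "dominating (ugraph.truncate L) S \<longleftrightarrow> accepting (lstate L S)"
proof -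
  let ?m = "vertex_of L"
  have r: "ran ?m \<subseteq> verts L" using labelled_graphD[OF assms(1)] by blast
  have "dominating (ugraph.truncate L) S \<longleftrightarrow>
      (\<forall>v\<in>verts L - ran ?m. v \<in> S \<or> (\<exists>u\<in>S. {u, v} \<in> edges L)) \<and>
      (\<forall>v\<in>ran ?m. v \<in> S \<or> (\<exists>u\<in>S - ran ?m. {u, v} \<in> edges L) \<or> (\<exists>u\<in>S \<inter> ran ?m. {u, v} \<in> edges L))"
  proof -
    have "verts L = (verts L - ran ?m) \<union> ran ?m" using r by auto
    moreover have "(\<exists>u\<in>S. {u, v} \<in> edges L) \<longleftrightarrow>
        (\<exists>u\<in>S - ran ?m. {u, v} \<in> edges L) \<or> (\<exists>u\<in>S \<inter> ran ?m. {u, v} \<in> edges L)" for v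
      by blast
    ultimately show ?thesis
      using assms(2) by (auto simp: dominating_def ugraph.truncate_def)
  qed
  also have "\<dots> \<longleftrightarrow> accepting (lstate L S)"
    unfolding state_of_def accepting.simps
  proof (rule arg_cong2[where f = "(\<and>)", OF refl], goal_cases)
    case 1
    let ?Q = "\<lambda>v. v \<in> S \<or> (\<exists>u\<in>S - ran ?m. {u, v} \<in> edges L) \<or> (\<exists>u\<in>S \<inter> ran ?m. {u, v} \<in> edges L)"
    let ?A = "{i. \<exists>u\<in>S. ?m i = Some u}"
    let ?R = "\<lambda>i. i \<in> ?A \<or> i \<in> {i. \<exists>v. ?m i = Some v \<and> (\<exists>u\<in>S - ran ?m. {u, v} \<in> edges L)} \<or>
        (\<exists>j\<in>?A. (j, i) \<in> {(i, j). \<exists>u v. ?m i = Some u \<and> ?m j = Some v \<and> {u, v} \<in> edges L})"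
    have Q: "(\<forall>v\<in>ran ?m. ?Q v) \<longleftrightarrow> (\<forall>i v. ?m i = Some v \<longrightarrow> ?Q v)" by (auto simp: ran_def)
    have "(\<forall>i\<in>dom ?m. R i) \<longleftrightarrow> (\<forall>i v. ?m i = Some v \<longrightarrow> R i)" for R by auto
    from this have R: "(\<forall>i\<in>dom ?m. ?R i) \<longleftrightarrow> (\<forall>i v. ?m i = Some v \<longrightarrow> ?R i)" .
    have QR: "?Q v \<longleftrightarrow> ?R i" if i: "?m i = Some v" for i v
    proof -
      have "(\<exists>u\<in>S \<inter> ran ?m. {u, v} \<in> edges L) \<longleftrightarrow> (\<exists>j\<in>?A. \<exists>u. ?m j = Some u \<and> {u, v} \<in> edges L)"
        unfolding ran_def by auto
      then show ?thesis by (simp add: i)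
    qed
    show ?case unfolding Q R by (intro iff_allI imp_cong refl QR)
  qed
  finally show ?thesis .
qed

section \<open>Transfer matrices\<close>

definition states :: "nat \<Rightarrow> state set" where
  "states k = Pow {1..k} \<times> Pow ({1..k} \<times> {1..k}) \<times> Pow {1..k} \<times> Pow {1..k} \<times> UNIV"

lemma finite_states: "finite (states k)"
  unfolding states_def by (intro finite_cartesian_product) auto

lemma lstate_in_states: "labelled_graph k L \<Longrightarrow> lstate L S \<in> states k"
  unfolding states_def state_of_def using labelled_graphD(5)[of k L] by fastforce

text \<open>
  Sets that do not dominate are counted as well, since a set may become dominating when edges are
  added.
\<close>

definition weight :: "nat lgraph \<Rightarrow> state \<Rightarrow> rat poly" where
  "weight L s = (\<Sum>S | S \<subseteq> verts L \<and> lstate L S = s. monom 1 (card S))"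

lemma sum_lstate:
  assumes "labelled_graph k L"
  shows "(\<Sum>S | S \<subseteq> verts L \<and> R (lstate L S). monom 1 (card S)) =
    (\<Sum>s\<in>states k. if R s then weight L s else 0)"
proof -
  have "finite (Pow (verts L))" using labelled_graphD(1)[OF assms] by simp
  then have "finite {S. S \<subseteq> verts L \<and> R (lstate L S)}" by (simp add: Pow_def finite_subset[of _ "{S. S \<subseteq> verts L}"] Collect_mono)
  then have "(\<Sum>S | S \<subseteq> verts L \<and> R (lstate L S). monom 1 (card S)) =
    (\<Sum>s\<in>states k. \<Sum>S | S \<in> {S. S \<subseteq> verts L \<and> R (lstate L S)} \<and> lstate L S = s. monom 1 (card S) :: rat poly)"
    by (intro sum.group[symmetric] finite_states) (use lstate_in_states[OF assms] in auto)
  also have "\<dots> = (\<Sum>s\<in>states k. if R s then weight L s else 0)"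
    by (intro sum.cong refl) (auto simp: weight_def intro!: sum.cong sum.neutral)
  finally show ?thesis .
qed

text \<open>
  The matrix does not depend on \<open>L\<close>: the shape of the labelled part is a component of the state,
  so the step from one graph of the sequence to the next is always the same linear map.
\<close>

definition transfer :: "nat \<Rightarrow> (nat lgraph \<Rightarrow> nat lgraph) \<Rightarrow> (state \<Rightarrow> state \<Rightarrow> rat poly) \<Rightarrow> bool" where
  "transfer k \<phi> T \<longleftrightarrow> (\<forall>L. labelled_graph k L \<longrightarrow> labelled_graph k (\<phi> L) \<and>
     (\<forall>t. weight (\<phi> L) t = (\<Sum>s\<in>states k. T s t * weight L s)))"

lemma sum_subsets_insert:
  assumes fin: "finite V" and v: "v \<notin> V"
  shows "(\<Sum>S | S \<subseteq> insert v V \<and> R S. monom 1 (card S) :: 'a::comm_semiring_1 poly) =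
    (\<Sum>S | S \<subseteq> V \<and> R S. monom 1 (card S)) +
    monom 1 1 * (\<Sum>S | S \<subseteq> V \<and> R (insert v S). monom 1 (card S))"
proof -
  let ?X = "{S. S \<subseteq> V \<and> R S}" and ?Y = "{S. S \<subseteq> V \<and> R (insert v S)}"
  have fin': "finite ?X" "finite ?Y"
    using fin by (auto intro: finite_subset[of _ "Pow V"])
  have Z: "{S. S \<subseteq> insert v V \<and> R S} = ?X \<union> insert v ` ?Y" (is "?Z = _")
  proof (intro Set.set_eqI iffI)
    fix S assume S: "S \<in> ?Z"
    show "S \<in> ?X \<union> insert v ` ?Y"
    proof (cases "v \<in> S")
      case True
      then have "insert v (S - {v}) = S" by blast
      then show ?thesis using S by (intro UnI2 image_eqI[of _ _ "S - {v}"]) auto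
    qed (use S in auto)
  qed auto
  have "(\<Sum>S\<in>?Z. monom 1 (card S) :: 'a poly) =
      (\<Sum>S\<in>?X. monom 1 (card S)) + (\<Sum>S\<in>insert v ` ?Y. monom 1 (card S))"
    unfolding Z using fin' v by (intro sum.union_disjoint) auto
  also have "(\<Sum>S\<in>insert v ` ?Y. monom 1 (card S) :: 'a poly) = (\<Sum>S\<in>?Y. monom 1 (card (insert v S)))"
    by (subst sum.reindex) (use v in \<open>auto intro!: inj_onI\<close>)
  also have "\<dots> = monom 1 1 * (\<Sum>S\<in>?Y. monom 1 (card S))"
    unfolding sum_distrib_left
  proof (intro sum.cong refl)
    fix S assume "S \<in> ?Y"
    then have "card (insert v S) = 1 + card S" using v finite_subset[OF _ fin, of S] by (subst card_insert_disjoint) auto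
    then show "monom 1 (card (insert v S)) = monom 1 1 * (monom 1 (card S) :: 'a poly)"
      by (simp add: mult_monom)
  qed
  finally show ?thesis .
qed

text \<open>
  Every operation sends a state to a single state, except that a new vertex may be in the set or
  not; in the former case the size grows by one, whence the factor \<open>monom 1 1\<close>.
\<close>

lemma transfer_apply_op:
  assumes "valid_op k p" shows "\<exists>T. transfer k (apply_op p) T"
proof -
  define T :: "state \<Rightarrow> state \<Rightarrow> rat poly" where
    "T s t = (if state_op p s = t then 1 else 0) +
       (case p of Add_Vertex i \<Rightarrow> if select_label i (state_op p s) = t then monom 1 1 else 0 | _ \<Rightarrow> 0)" for s t
  have "weight (apply_op p L) t = (\<Sum>s\<in>states k. T s t * weight L s)" if L: "labelled_graph k L" for L t
  proof -
    note st = lstate_apply_op[OF L _ assms]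
    have fin: "finite (verts L)" using labelled_graphD(1)[OF L] .
    have old: "(\<Sum>S | S \<subseteq> verts L \<and> lstate (apply_op p L) S = t. monom 1 (card S)) =
        (\<Sum>s\<in>states k. if state_op p s = t then weight L s else 0)"
    proof -
      have "{S. S \<subseteq> verts L \<and> lstate (apply_op p L) S = t} =
          {S. S \<subseteq> verts L \<and> state_op p (lstate L S) = t}"
        using st(1) by auto
      then show ?thesis by (simp only: sum_lstate[OF L, of "\<lambda>s. state_op p s = t"])
    qed
    show ?thesis
    proof (cases "\<exists>i. p = Add_Vertex i")
      case False
      then have v: "verts (apply_op p L) = verts L" by (auto simp: verts_apply_op split: elem_op.split)
      have T: "T s t * weight L s = (if state_op p s = t then weight L s else 0)" for s
        using False by (auto simp: T_def split: elem_op.split)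
      show ?thesis by (simp only: T old[symmetric] weight_def[of "apply_op p L"] v)
    next
      case True
      then obtain i where p: "p = Add_Vertex i" by blast
      have Tw: "T s t * weight L s = (if state_op p s = t then weight L s else 0) +
          monom 1 1 * (if select_label i (state_op p s) = t then weight L s else 0)" for s
        using p by (simp add: T_def distrib_right del: state_op.simps)
      obtain v where v: "v = (LEAST v. v \<notin> verts L)" "v \<notin> verts L"
        using least_unused[OF fin] by blast
      have vs: "verts (apply_op p L) = insert v (verts L)" by (simp add: p Let_def v(1))
      have "weight (apply_op p L) t =
          (\<Sum>S | S \<subseteq> verts L \<and> lstate (apply_op p L) S = t. monom 1 (card S)) +
          monom 1 1 * (\<Sum>S | S \<subseteq> verts L \<and> lstate (apply_op p L) (insert v S) = t. monom 1 (card S))"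
        unfolding weight_def using sum_subsets_insert[OF fin v(2)] by (simp only: vs)
      also have "{S. S \<subseteq> verts L \<and> lstate (apply_op p L) (insert v S) = t} = {S. S \<subseteq> verts L \<and> select_label i (state_op p (lstate L S)) = t}"
        using st(2)[OF _ p] v(1) by auto
      also have "(\<Sum>S | S \<subseteq> verts L \<and> select_label i (state_op p (lstate L S)) = t. monom 1 (card S)) =
          (\<Sum>s\<in>states k. if select_label i (state_op p s) = t then weight L s else 0)"
        by (rule sum_lstate[OF L])
      finally show ?thesis
        unfolding old Tw sum.distrib sum_distrib_left .
    qed
  qed
  then have "transfer k (apply_op p) T"
    unfolding transfer_def using labelled_graph_apply_op[OF _ assms] by blast
  then show ?thesis by (rule exI[of _ T])
qed

lemma transfer_comp:
  assumes T: "transfer k \<phi> T" and T': "transfer k \<psi> T'"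
  shows "transfer k (\<psi> \<circ> \<phi>) (\<lambda>s t. \<Sum>r\<in>states k. T' r t * T s r)"
  unfolding transfer_def
proof (intro allI impI conjI)
  fix L :: "nat lgraph" and t assume L: "labelled_graph k L"
  then have "labelled_graph k (\<phi> L)" using T by (simp add: transfer_def)
  then show "labelled_graph k ((\<psi> \<circ> \<phi>) L)" using T' by (simp add: transfer_def)
  have "weight ((\<psi> \<circ> \<phi>) L) t = (\<Sum>r\<in>states k. T' r t * (\<Sum>s\<in>states k. T s r * weight L s))"
    using T T' L \<open>labelled_graph k (\<phi> L)\<close> by (simp add: transfer_def del: split_paired_All)
  also have "\<dots> = (\<Sum>s\<in>states k. (\<Sum>r\<in>states k. T' r t * T s r) * weight L s)"
    unfolding sum_distrib_left sum_distrib_right by (subst sum.swap) (simp add: mult.assoc)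
  finally show "weight ((\<psi> \<circ> \<phi>) L) t = (\<Sum>s\<in>states k. (\<Sum>r\<in>states k. T' r t * T s r) * weight L s)" .
qed

lemma transfer_fold:
  assumes "\<forall>p\<in>set ops. valid_op k p" shows "\<exists>T. transfer k (fold apply_op ops) T"
  using assms
proof (induction ops)
  case Nil
  have "transfer k id (\<lambda>s t. if s = t then 1 else 0)"
    unfolding transfer_def
  proof (intro allI impI conjI)
    fix L :: "nat lgraph" and t assume L: "labelled_graph k L"
    then show "labelled_graph k (id L)" by simp
    have "weight L t = 0" if "t \<notin> states k"
    proof -
      have "{S. S \<subseteq> verts L \<and> lstate L S = t} = {}" using lstate_in_states[OF L] that by auto
      then show ?thesis by (simp only: weight_def sum.empty)
    qed
    then show "weight (id L) t = (\<Sum>s\<in>states k. (if s = t then 1 else 0) * weight L s)"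
      using finite_states[of k] by (simp add: if_distrib[of "\<lambda>x. x * _"] cong: if_cong)
  qed
  then show ?case unfolding fold_Nil by blast
next
  case (Cons p ops)
  then obtain T T' where "transfer k (apply_op p) T" "transfer k (fold apply_op ops) T'"
    using transfer_apply_op[of k p] by auto
  then show ?case unfolding fold_Cons using transfer_comp by blast
qed

definition domination_poly :: "'v ugraph \<Rightarrow> rat poly" where
  "domination_poly G = (\<Sum>S | dominating G S. monom 1 (card S))"

lemma dom_count_eq_coeff:
  assumes "finite (verts G)"
  shows "of_nat (dom_count G i) = (if i < 0 then 0 else coeff (domination_poly G) (nat i))"
proof -
  have fin: "finite {S. dominating G S}"
    using assms by (auto simp: dominating_def intro: finite_subset[of _ "Pow (verts G)"])
  have "coeff (domination_poly G) n = of_nat (card {S. dominating G S \<and> card S = n})" for n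
    unfolding domination_poly_def coeff_sum coeff_monom using fin
    by (simp add: sum.If_cases Int_def)
  moreover have "{S. dominating G S \<and> int (card S) = i} =
     (if i < 0 then {} else {S. dominating G S \<and> card S = nat i})" by auto
  ultimately show ?thesis by (simp add: dom_count_def)
qed

lemma dom_count_iso:
  assumes "graph_iso G H" "finite (verts G)" "\<And>e. e \<in> edges G \<Longrightarrow> e \<subseteq> verts G"
  shows "dom_count G i = dom_count H i"
proof -
  obtain f where f: "bij_betw f (verts G) (verts H)" "edges H = (\<lambda>e. f ` e) ` edges G"
    using assms(1) by (auto simp: graph_iso_def)
  have inj: "inj_on f (verts G)" and im: "f ` verts G = verts H"
    using f(1) by (auto simp: bij_betw_def)
  have e: "{f u, f v} \<in> edges H \<longleftrightarrow> {u, v} \<in> edges G" if "u \<in> verts G" "v \<in> verts G" for u v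
  proof -
    have "f ` e = f ` {u, v} \<longleftrightarrow> e = {u, v}" if "e \<in> edges G" for e
      by (rule inj_on_image_eq_iff[OF inj assms(3)[OF that]]) (use \<open>u \<in> _\<close> \<open>v \<in> _\<close> in auto)
    moreover have "{f u, f v} = f ` {u, v}" by simp
    ultimately show ?thesis unfolding f(2) by (metis (no_types, lifting) image_iff)
  qed
  have dom: "dominating H (f ` S) \<longleftrightarrow> dominating G S" if S: "S \<subseteq> verts G" for S
  proof -
    have "f v \<in> f ` S \<longleftrightarrow> v \<in> S" if "v \<in> verts G" for v
      using inj_on_image_mem_iff[OF inj that S] .
    moreover have "(\<exists>u\<in>f ` S. {u, f v} \<in> edges H) \<longleftrightarrow> (\<exists>u\<in>S. {u, v} \<in> edges G)" if "v \<in> verts G" for v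
      using e[OF _ that] S by auto
    ultimately show ?thesis unfolding dominating_def using S by (auto simp flip: im)
  qed
  have "bij_betw (\<lambda>S. f ` S) {S. dominating G S \<and> int (card S) = i} {S. dominating H S \<and> int (card S) = i}"
    unfolding bij_betw_def
  proof (intro conjI Set.set_eqI iffI)
    show "inj_on (\<lambda>S. f ` S) {S. dominating G S \<and> int (card S) = i}"
      by (rule inj_onI) (auto simp: dominating_def inj_on_image_eq_iff[OF inj])
  next
    fix T assume "T \<in> (\<lambda>S. f ` S) ` {S. dominating G S \<and> int (card S) = i}"
    then obtain S where S: "T = f ` S" "dominating G S" "int (card S) = i" by blast
    then have "S \<subseteq> verts G" by (simp add: dominating_def)
    then show "T \<in> {S. dominating H S \<and> int (card S) = i}"
      using S dom card_image[OF inj_on_subset[OF inj]] by auto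
  next
    fix T assume T: "T \<in> {S. dominating H S \<and> int (card S) = i}"
    then have "T \<subseteq> f ` verts G" by (auto simp: dominating_def im)
    then obtain S where S: "S \<subseteq> verts G" "T = f ` S" by (meson subset_imageE)
    then show "T \<in> (\<lambda>S. f ` S) ` {S. dominating G S \<and> int (card S) = i}"
      using T dom[OF S(1)] card_image[OF inj_on_subset[OF inj S(1)]] by auto
  qed
  then show ?thesis unfolding dom_count_def by (rule bij_betw_same_card)
qed

section \<open>A linear recurrence for domination polynomials\<close>

text \<open>
  Whether a set dominates is visible from its state, so the domination polynomial is the sum of
  the weights of the accepting states.
\<close>

lemma sum_dominating_eq_weights:
  assumes "labelled_graph k L"
  shows "domination_poly (ugraph.truncate L) =
    (\<Sum>s\<in>states k. if accepting s then weight L s else 0)"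
proof -
  have "{S. dominating (ugraph.truncate L) S} = {S. S \<subseteq> verts L \<and> accepting (lstate L S)}"
    using dominating_iff_accepting[OF assms] by (auto simp: dominating_def ugraph.truncate_def)
  then show ?thesis unfolding domination_poly_def by (simp only: sum_lstate[OF assms])
qed

text \<open>
  The weight vectors of one more graph than there are states satisfy a linear relation over the
  polynomial ring. Applying the transfer matrix moves this relation along the sequence. The
  relation need not be monic.
\<close>

lemma domination_poly_recurrence:
  assumes "recursively_constructible G"
  shows "\<exists>N (a :: nat \<Rightarrow> rat poly) D. (\<exists>j\<le>N. a j \<noteq> 0) \<and>
    (\<forall>n\<ge>1. (\<Sum>j\<le>N. a j * D (n + j)) = 0) \<and>
    (\<forall>n\<ge>1. \<forall>i. of_nat (dom_count (G n) i) = (if i < 0 then 0 else coeff (D n) (nat i)))"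
proof -
  obtain k ops L where k: "\<forall>p\<in>set ops. valid_op k p" "labelled_graph k (L 1)"
      "\<And>n. n \<ge> 1 \<Longrightarrow> L (Suc n) = fold apply_op ops (L n)"
      "\<And>n. n \<ge> 1 \<Longrightarrow> graph_iso (ugraph.truncate (L n)) (G n)"
    using assms unfolding recursively_constructible_def by blast
  obtain T where T: "transfer k (fold apply_op ops) T" using transfer_fold[OF k(1)] by blast
  have L: "labelled_graph k (L n)" if "n \<ge> 1" for n
    using that
  proof (induction n rule: dec_induct)
    case (step n)
    then show ?case using T k(3)[of n] by (simp add: transfer_def del: split_paired_All)
  qed (use k(2) in simp)
  have W: "weight (L (Suc n)) t = (\<Sum>s\<in>states k. T s t * weight (L n) s)" if "n \<ge> 1" for n t
    using that L[OF that] T k(3)[OF that] by (simp add: transfer_def del: split_paired_All)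
  define N where "N = card (states k)"
  obtain a where a: "\<exists>j\<in>{..N}. a j \<noteq> 0" "\<And>s. s \<in> states k \<Longrightarrow> (\<Sum>j\<le>N. a j * weight (L (1 + j)) s) = 0"
    using homogeneous_system[OF finite_states[of k], of "{..N}" "\<lambda>s j. weight (L (1 + j)) s"]
    by (auto simp: N_def)
  have rec: "\<forall>s\<in>states k. (\<Sum>j\<le>N. a j * weight (L (n + j)) s) = 0" if "n \<ge> 1" for n
    using that
  proof (induction n rule: dec_induct)
    case base
    then show ?case using a(2) by blast
  next
    case (step n)
    show ?case
    proof
      fix t assume "t \<in> states k"
      have "(\<Sum>j\<le>N. a j * weight (L (Suc n + j)) t) =
          (\<Sum>j\<le>N. \<Sum>s\<in>states k. T s t * (a j * weight (L (n + j)) s))"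
        using W[of "n + _" t] step(1) by (simp add: sum_distrib_left mult.left_commute)
      also have "\<dots> = (\<Sum>s\<in>states k. T s t * (\<Sum>j\<le>N. a j * weight (L (n + j)) s))"
        by (subst sum.swap) (simp add: sum_distrib_left)
      also have "\<dots> = 0" using step(3) by simp
      finally show "(\<Sum>j\<le>N. a j * weight (L (Suc n + j)) t) = 0" .
    qed
  qed
  define D where "D n = domination_poly (ugraph.truncate (L n))" for n
  have "(\<Sum>j\<le>N. a j * D (n + j)) = 0" if n: "n \<ge> 1" for n
  proof -
    have "(\<Sum>j\<le>N. a j * D (n + j)) =
        (\<Sum>j\<le>N. \<Sum>s\<in>states k. if accepting s then a j * weight (L (n + j)) s else 0)"
      unfolding D_def using sum_dominating_eq_weights[OF L[of "n + _"]] n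
      by (simp add: sum_distrib_left if_distrib[of "\<lambda>x. _ * x"] cong: if_cong)
    also have "\<dots> = (\<Sum>s\<in>states k. if accepting s then \<Sum>j\<le>N. a j * weight (L (n + j)) s else 0)"
    proof (subst sum.swap, intro sum.cong refl)
      fix s
      show "(\<Sum>j\<le>N. if accepting s then a j * weight (L (n + j)) s else 0) =
          (if accepting s then \<Sum>j\<le>N. a j * weight (L (n + j)) s else 0)"
        by (cases "accepting s") simp_all
    qed
    also have "\<dots> = 0"
    proof (intro sum.neutral ballI)
      fix s assume "s \<in> states k"
      from bspec[OF rec[OF n] this]
      show "(if accepting s then \<Sum>j\<le>N. a j * weight (L (n + j)) s else 0) = 0"
        by (simp only: if_cancel)
    qed
    finally show ?thesis .
  qed
  moreover have "of_nat (dom_count (G n) i) = (if i < 0 then 0 else coeff (D n) (nat i))" if n: "n \<ge> 1" for n i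
  proof -
    note g = labelled_graphD(1,2)[OF L[OF n]]
    have "dom_count (ugraph.truncate (L n)) i = dom_count (G n) i"
      by (rule dom_count_iso[OF k(4)[OF n]]) (use g in \<open>auto simp: ugraph.truncate_def\<close>)
    then show ?thesis
      using dom_count_eq_coeff[of "ugraph.truncate (L n)" i] g by (simp add: D_def ugraph.truncate_def)
  qed
  ultimately show ?thesis using a(1) by blast
qed

section \<open>Generating functions along lines\<close>

lemma polynomial_in_rational_functions: "fps_to_fls (fps_of_poly p) \<in> rational_functions"
  unfolding rational_functions_def by (rule CollectI, rule exI[of _ p], rule exI[of _ 1]) simp

lemma is_subfield_rational_functions: "is_subfield rational_functions"
proof -
  let ?\<iota> = "\<lambda>p::rat poly. fps_to_fls (fps_of_poly p)"
  have hom: "?\<iota> (p * q) = ?\<iota> p * ?\<iota> q" "?\<iota> (p - q) = ?\<iota> p - ?\<iota> q" for p q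
    by (simp_all add: fps_of_poly_mult fps_of_poly_diff fls_times_fps_to_fls fps_to_fls_minus)
  have nz: "?\<iota> p = 0 \<longleftrightarrow> p = 0" for p
    by (simp add: fps_to_fls_eq_0_iff)
  have 01: "0 \<in> rational_functions" "1 \<in> rational_functions"
    using polynomial_in_rational_functions[of 0] polynomial_in_rational_functions[of 1] by simp_all
  have "x - y \<in> rational_functions \<and> x * y \<in> rational_functions \<and> x / y \<in> rational_functions"
    if xy: "x \<in> rational_functions" "y \<in> rational_functions" for x y
  proof -
    from xy obtain a b c d where x: "x = ?\<iota> a / ?\<iota> b" "b \<noteq> 0" and y: "y = ?\<iota> c / ?\<iota> d" "d \<noteq> 0"
      unfolding rational_functions_def by blast
    have I: "?\<iota> p / ?\<iota> r \<in> rational_functions" if "r \<noteq> 0" for p r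
      using that unfolding rational_functions_def by blast
    have "x - y = ?\<iota> (a * d - c * b) / ?\<iota> (b * d)"
      using x y by (simp add: hom nz diff_frac_eq)
    moreover have "x * y = ?\<iota> (a * c) / ?\<iota> (b * d)" using x y by (simp add: hom)
    moreover have "x / y = ?\<iota> (a * d) / ?\<iota> (b * c)" using x y by (simp add: hom)
    moreover have "x / y \<in> rational_functions" if "c = 0" using that y 01(1) by simp
    moreover have "b * d \<noteq> 0" "c \<noteq> 0 \<Longrightarrow> b * c \<noteq> 0" using x y by auto
    ultimately show ?thesis
      using I[of "b * d"] I[of "b * c"] by metis
  qed
  then show ?thesis using 01 by (simp add: is_subfield_def)
qed

lemma fps_to_fls_sum: "fps_to_fls (\<Sum>x\<in>A. f x) = (\<Sum>x\<in>A. fps_to_fls (f x))"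
  by (induction A rule: infinite_finite_induct) simp_all

lemma finite_support_one_sided:
  assumes "finite {i. c i \<noteq> 0}"
  shows "left_finite c" "right_finite c"
proof -
  let ?S = "insert 0 {i. c i \<noteq> 0}"
  have "c i = 0" if "i < Min ?S" for i using assms that Min_le[of ?S i] by force
  then show "left_finite c" unfolding left_finite_def by blast
  have "c i = 0" if "i > Max ?S" for i using assms that Max_ge[of ?S i] by force
  then show "right_finite c" unfolding right_finite_def by blast
qed

text \<open>
  An array \<open>d n l\<close> whose rows, read as Laurent polynomials, satisfy a linear recurrence from row 1
  on, so that their bivariate generating function is rational.
\<close>

locale bounded_recurrence =
  fixes d :: "nat \<Rightarrow> int \<Rightarrow> rat" and \<alpha> :: "nat \<Rightarrow> nat \<Rightarrow> rat" and N E :: nat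
  assumes nontrivial: "\<exists>j\<le>N. \<exists>e\<le>E. \<alpha> j e \<noteq> 0"
    and recurrence: "\<And>n l. n \<ge> 1 \<Longrightarrow> (\<Sum>j\<le>N. \<Sum>e\<le>E. \<alpha> j e * d (n + j) (l - int e)) = 0"
    and finite_support: "\<And>n. n \<ge> 1 \<Longrightarrow> finite {l. d n l \<noteq> 0}"
begin

text \<open>
  For rational slope \<open>a / b\<close> the entries \<open>d n l\<close> with \<open>b * l = i + a * n\<close> lie on a line. Writing \<open>D n\<close> for the rows
  as Laurent polynomials, this is the generating function of the coefficients of \<open>x ^ i\<close> in the Laurent
  polynomials \<open>D n (x ^ b) * x ^ (- a * n)\<close>; the substitution avoids a case distinction by
  residues of \<open>n\<close>.
\<close>

definition slice :: "int \<Rightarrow> int \<Rightarrow> int \<Rightarrow> rat fps" where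
  "slice a b i = Abs_fps (\<lambda>n. if n = 0 then 0
     else if b dvd i + a * int n then d n ((i + a * int n) div b) else 0)"

text \<open>
  As \<open>i\<close> varies, the slices form a decaying sequence, and the recurrence makes its product with a
  polynomial \<open>Q\<close> finite.
\<close>

lemma slice_algebraic:
  assumes b: "b > 0"
  shows "fps_to_fls (slice a b i) \<in> algebraics rational_functions"
proof -
  note R = is_subfield_rational_functions
  define c where "c i = fps_to_fls (slice a b i)" for i
  \<comment> \<open>The summand \<open>abs a * N\<close> makes all exponents nonnegative for \<open>j \<le> N\<close>, also for a negative slope.\<close>
  define sh where "sh j e = nat (b * int e + a * int j + \<bar>a\<bar> * int N)" for j e
  have sh: "int (sh j e) = b * int e + a * int j + \<bar>a\<bar> * int N" if "j \<le> N" for j e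
  proof -
    have "\<bar>a * int j\<bar> \<le> \<bar>a\<bar> * int N" using that by (simp add: abs_mult mult_left_mono)
    moreover have "0 \<le> b * int e" using b by simp
    ultimately have "0 \<le> b * int e + a * int j + \<bar>a\<bar> * int N" by linarith
    then show ?thesis by (simp add: sh_def)
  qed
  define A where "A j e = fps_of_poly (monom (\<alpha> j e) (N - j))" for j e
  define Q where "Q = (\<Sum>j\<le>N. \<Sum>e\<le>E. monom (fps_to_fls (A j e)) (sh j e))"
  have coeffQ: "coeff Q l = (\<Sum>j\<le>N. \<Sum>e\<le>E. if sh j e = l then fps_to_fls (A j e) else 0)" for l
    by (simp add: Q_def coeff_sum)
  have Q: "coeffs_in rational_functions Q"
    unfolding coeffs_in_def coeffQ
    using is_subfield_simps(1)[OF R]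
    by (auto intro!: is_subfield_sum[OF R] simp: A_def polynomial_in_rational_functions)
  have "Q \<noteq> 0"
  proof -
    obtain j0 e0 where je: "j0 \<le> N" "e0 \<le> E" "\<alpha> j0 e0 \<noteq> 0" using nontrivial by blast
    have "fls_nth (coeff Q (sh j0 e0)) (int (N - j0)) =
        (\<Sum>j\<le>N. \<Sum>e\<le>E. if j = j0 \<and> e = e0 then \<alpha> j0 e0 else 0)"
      unfolding coeffQ fls_nth_sum
    proof (intro sum.cong refl)
      fix j e assume "j \<in> {..N}" "e \<in> {..E}"
      then have "sh j e = sh j0 e0 \<and> j = j0 \<longleftrightarrow> j = j0 \<and> e = e0"
      proof (cases "j = j0")
        case True
        have "sh j0 e = sh j0 e0 \<longleftrightarrow> int (sh j0 e) = int (sh j0 e0)" by simp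
        also have "\<dots> \<longleftrightarrow> e = e0" unfolding sh[OF je(1)] using b by simp
        finally show ?thesis using True by simp
      qed simp
      moreover have "fls_nth (fps_to_fls (A j e)) (int (N - j0)) = (if j = j0 then \<alpha> j e else 0)"
        using je \<open>j \<in> {..N}\<close> by (auto simp: A_def)
      ultimately show "fls_nth (if sh j e = sh j0 e0 then fps_to_fls (A j e) else 0) (int (N - j0)) =
          (if j = j0 \<and> e = e0 then \<alpha> j0 e0 else 0)"
        by (auto split: if_splits)
    qed
    also have "\<dots> = (\<Sum>j\<le>N. if j = j0 then \<alpha> j0 e0 else 0)"
      by (intro sum.cong refl) (use je in \<open>auto simp: if_distrib cong: if_cong\<close>)
    also have "\<dots> = \<alpha> j0 e0" using je by simp
    finally show ?thesis using je by auto
  qed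
  \<comment> \<open>Beyond exponent \<open>N\<close> the recurrence applies, so \<open>Q * c\<close> consists of polynomials.\<close>
  define P where "P i = (\<Sum>j\<le>N. \<Sum>e\<le>E. A j e * slice a b (i - int (sh j e)))" for i
  have act: "act Q c i = fps_to_fls (P i)" for i
    unfolding Q_def act_sum_poly act_monom P_def c_def
    by (simp add: fps_to_fls_sum fls_times_fps_to_fls)
  have P0: "fps_nth (P i) M = 0" if M: "M > N" for i M
  proof -
    define n where "n = M - N"
    define t where "t = i - \<bar>a\<bar> * int N + a * int n"
    have n: "n \<ge> 1" "M = N + n" using M by (auto simp: n_def)
    have "fps_nth (A j e * slice a b (i - int (sh j e))) M =
        (if b dvd t then \<alpha> j e * d (n + j) (t div b - int e) else 0)" if j: "j \<le> N" for j e
    proof -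
      have ix: "M - (N - j) = n + j" "\<not> M < N - j" "n + j \<noteq> 0" using n j by auto
      have t: "i - int (sh j e) + a * int (n + j) = t - b * int e"
        unfolding t_def sh[OF j] by (simp add: algebra_simps)
      have dv: "b dvd t - b * int e \<longleftrightarrow> b dvd t" by (simp add: dvd_diff_left_iff)
      have "(t - b * int e) div b = t div b - int e"
        using div_mult_self2[of b t "- int e"] b by simp
      then have "fps_nth (slice a b (i - int (sh j e))) (n + j) =
          (if b dvd t then d (n + j) (t div b - int e) else 0)"
        unfolding slice_def fps_nth_Abs_fps t dv using ix by auto
      then show ?thesis
        unfolding A_def fps_of_poly_monom using ix
        by (simp add: mult.assoc fps_X_power_mult_nth)
    qed
    then have "fps_nth (P i) M =
        (\<Sum>j\<le>N. \<Sum>e\<le>E. if b dvd t then \<alpha> j e * d (n + j) (t div b - int e) else 0)"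
      by (simp add: P_def fps_sum_nth)
    also have "\<dots> = 0" using recurrence[OF n(1), of "t div b"] by (cases "b dvd t") simp_all
    finally show ?thesis .
  qed
  have act_in: "act Q c i \<in> rational_functions" for i
  proof -
    have "P i = fps_of_poly (\<Sum>m\<le>N. monom (fps_nth (P i) m) m)"
      using P0[of _ i] by (intro fps_ext) (auto simp: coeff_sum not_le)
    then obtain r where "P i = fps_of_poly r" by blast
    then show ?thesis by (simp add: act polynomial_in_rational_functions)
  qed
  \<comment> \<open>Each row has finite support, so only finitely many slices involve the first \<open>n\<close> rows.\<close>
  have "decays c"
    unfolding decays_def
  proof
    fix n
    let ?B = "\<Union>m\<in>{1..<nat n}. (\<lambda>l. b * l - a * int m) ` {l. d m l \<noteq> 0}"
    have "{i. \<not> ord_ge n (c i)} \<subseteq> ?B"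
    proof
      fix i assume "i \<in> {i. \<not> ord_ge n (c i)}"
      then obtain m where m: "m < n" "fls_nth (c i) m \<noteq> 0" by (auto simp: ord_ge_def)
      define k where "k = nat m"
      have nz: "fps_nth (slice a b i) k \<noteq> 0" "m \<ge> 0"
        using m(2) by (auto simp: c_def k_def split: if_splits)
      then have k: "k \<noteq> 0" "b dvd i + a * int k" "d k ((i + a * int k) div b) \<noteq> 0"
        by (auto simp: slice_def split: if_splits)
      then have "i = b * ((i + a * int k) div b) - a * int k" by simp
      moreover have "k \<in> {1..<nat n}" using k(1) m(1) nz(2) by (auto simp: k_def)
      ultimately show "i \<in> ?B" using k(3) by blast
    qed
    moreover have "finite ?B" using finite_support by auto
    ultimately show "finite {i. \<not> ord_ge n (c i)}" by (rule finite_subset)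
  qed
  moreover have fin: "finite {i. act Q c i \<noteq> 0}"
  proof -
    have "act Q c i = 0" if "ord_ge (int N + 1) (act Q c i)" for i
    proof -
      have "fps_nth (P i) m = 0" for m
      proof (cases "m > N")
        case False
        then have "fls_nth (act Q c i) (int m) = 0" using that by (auto simp: ord_ge_def)
        then show ?thesis by (simp add: act)
      qed (rule P0)
      then have "P i = 0" by (intro fps_ext) simp
      then show ?thesis by (simp add: act)
    qed
    then have "{i. act Q c i \<noteq> 0} \<subseteq> {i. \<not> ord_ge (int N + 1) (act Q c i)}" by blast
    then show ?thesis using decaysD[OF decays_act[OF \<open>decays c\<close>]] by (rule finite_subset)
  qed
  ultimately have "c i \<in> algebraics rational_functions"
    using decaying_solution_algebraic[OF R \<open>Q \<noteq> 0\<close> Q _ act_in finite_support_one_sided[OF fin]] by blast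
  then show ?thesis by (simp add: c_def)
qed

text \<open>
  A window of \<open>b\<close> consecutive integers contains exactly one \<open>i\<close> with \<open>b dvd i + a * n\<close>. So a rounded line
  is the sum of \<open>b\<close> slices.
\<close>

lemma line_algebraic:
  assumes b: "b > 0" and line: "\<And>n. n \<ge> 1 \<Longrightarrow> s \<le> b * \<kappa> n - a * int n \<and> b * \<kappa> n - a * int n < s + b"
  shows "algebraic_fps (Abs_fps (\<lambda>n. if n = 0 then 0 else d n (\<kappa> n)))"
proof -
  have "Abs_fps (\<lambda>n. if n = 0 then 0 else d n (\<kappa> n)) = (\<Sum>i\<in>{s..<s + b}. slice a b i)"
  proof (rule fps_ext)
    fix n
    show "fps_nth (Abs_fps (\<lambda>n. if n = 0 then 0 else d n (\<kappa> n))) n =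
        fps_nth (\<Sum>i\<in>{s..<s + b}. slice a b i) n"
    proof (cases "n = 0")
      case False
      \<comment> \<open>The unique index in the window whose slice meets row \<open>n\<close>.\<close>
      define i0 where "i0 = b * \<kappa> n - a * int n"
      have i0: "i0 \<in> {s..<s + b}" using line[of n] False by (simp add: i0_def)
      have "fps_nth (slice a b i) n = (if i = i0 then d n (\<kappa> n) else 0)" if i: "i \<in> {s..<s + b}" for i
      proof (cases "b dvd i + a * int n")
        case True
        then obtain l where l: "i + a * int n = b * l" by blast
        have "\<bar>b * l - b * \<kappa> n\<bar> < b" using i i0 l by (auto simp: i0_def)
        then have "\<bar>b * (l - \<kappa> n)\<bar> < b * 1" by (simp add: right_diff_distrib)
        then have "l = \<kappa> n" using b unfolding abs_mult by (simp add: zero_less_mult_iff)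
        then show ?thesis using l b False by (auto simp: slice_def i0_def)
      next
        case False
        then show ?thesis by (auto simp: slice_def i0_def)
      qed
      then have "fps_nth (\<Sum>i\<in>{s..<s + b}. slice a b i) n =
          (\<Sum>i\<in>{s..<s + b}. if i = i0 then d n (\<kappa> n) else 0)"
        by (simp add: fps_sum_nth)
      then show ?thesis using i0 False by simp
    qed (simp add: slice_def fps_sum_nth)
  qed
  moreover have "fps_to_fls (\<Sum>i\<in>{s..<s + b}. slice a b i) \<in> algebraics rational_functions"
    unfolding fps_to_fls_sum
    by (rule is_subfield_sum[OF is_subfield_algebraics(1)[OF is_subfield_rational_functions]]
      slice_algebraic[OF b])+
  ultimately show ?thesis
    by (simp add: algebraic_fps_def algebraics_def coeffs_in_def)
qed

end

text \<open>
  Comparing coefficients in the polynomial recurrence. The sizes are integers here, so the entries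
  of negative index, which are all zero, have to be included.
\<close>

lemma ex_bounded_recurrence:
  assumes "recursively_constructible G"
  shows "\<exists>\<alpha> N E. bounded_recurrence (\<lambda>n i. of_nat (dom_count (G n) i)) \<alpha> N E"
proof -
  obtain N a D where a: "\<exists>j\<le>N. a j \<noteq> (0 :: rat poly)"
    and rec: "\<And>n. n \<ge> 1 \<Longrightarrow> (\<Sum>j\<le>N. a j * D (n + j)) = 0"
    and D: "\<And>n i. n \<ge> 1 \<Longrightarrow> of_nat (dom_count (G n) i) = (if i < 0 then 0 else coeff (D n) (nat i))"
    using domination_poly_recurrence[OF assms] by blast
  define E where "E = Max (degree ` a ` {..N})"
  have E: "degree (a j) \<le> E" if "j \<le> N" for j
    unfolding E_def by (rule Max_ge) (use that in auto)
  let ?d = "\<lambda>n i. of_nat (dom_count (G n) i) :: rat"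
  have "bounded_recurrence ?d (\<lambda>j. coeff (a j)) N E"
  proof
    obtain j where "j \<le> N" "a j \<noteq> 0" using a by blast
    then show "\<exists>j\<le>N. \<exists>e\<le>E. coeff (a j) e \<noteq> 0"
      using E by (intro exI[of _ j] conjI exI[of _ "degree (a j)"]) auto
  next
    fix n :: nat assume n: "n \<ge> 1"
    have "{l. ?d n l \<noteq> 0} \<subseteq> int ` {..degree (D n)}"
    proof
      fix l assume "l \<in> {l. ?d n l \<noteq> 0}"
      then have "l \<ge> 0" "coeff (D n) (nat l) \<noteq> 0" using D[OF n, of l] by (auto split: if_splits)
      then show "l \<in> int ` {..degree (D n)}" by (intro image_eqI[of _ _ "nat l"]) (auto intro: le_degree)
    qed
    then show "finite {l. ?d n l \<noteq> 0}" by (rule finite_subset) simp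
    fix l
    show "(\<Sum>j\<le>N. \<Sum>e\<le>E. coeff (a j) e * ?d (n + j) (l - int e)) = 0"
    proof (cases "l < 0")
      case True
      then show ?thesis using D n by (intro sum.neutral ballI) simp
    next
      case False
      define m where "m = nat l"
      have l: "l = int m" using False by (simp add: m_def)
      have "(\<Sum>e\<le>E. coeff (a j) e * ?d (n + j) (l - int e)) = coeff (a j * D (n + j)) m" if j: "j \<le> N" for j
      proof -
        have "(\<Sum>e\<le>E. coeff (a j) e * ?d (n + j) (l - int e)) =
            (\<Sum>e\<le>max E m. coeff (a j) e * ?d (n + j) (l - int e))"
          by (rule sum.mono_neutral_left) (use E[OF j] in \<open>auto simp: coeff_eq_0\<close>)
        also have "\<dots> = (\<Sum>e\<le>m. coeff (a j) e * ?d (n + j) (l - int e))"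
          by (rule sum.mono_neutral_right) (use D n l in auto)
        also have "\<dots> = (\<Sum>e\<le>m. coeff (a j) e * coeff (D (n + j)) (m - e))"
          by (intro sum.cong refl) (use D n l in \<open>simp add: nat_diff_distrib'\<close>)
        finally show ?thesis by (simp add: coeff_mult)
      qed
      then have "(\<Sum>j\<le>N. \<Sum>e\<le>E. coeff (a j) e * ?d (n + j) (l - int e)) =
          coeff (\<Sum>j\<le>N. a j * D (n + j)) m"
        by (simp add: coeff_sum)
      then show ?thesis using rec[OF n] by simp
    qed
  qed
  then show ?thesis by blast
qed

theorem theorem6p2:
  fixes G :: "nat \<Rightarrow> 'v ugraph" and q p :: rat
  assumes "recursively_constructible G"
  shows "algebraic_fps (Abs_fps (\<lambda>n. if n = 0 then 0
           else of_nat (dom_count (G n) \<lfloor>q * of_nat n + p\<rfloor>)))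
       \<and> algebraic_fps (Abs_fps (\<lambda>n. if n = 0 then 0
           else of_nat (dom_count (G n) \<lceil>q * of_nat n + p\<rceil>)))"
proof -
  obtain \<alpha> N E where "bounded_recurrence (\<lambda>n i. of_nat (dom_count (G n) i)) \<alpha> N E"
    using ex_bounded_recurrence[OF assms] by blast
  then interpret bounded_recurrence "\<lambda>n i. of_nat (dom_count (G n) i)" \<alpha> N E .
  obtain a b where b: "b > 0" and q: "q = of_int a / of_int b"
    by (cases q) (auto simp: Fract_of_int_quotient)
  have bq: "of_int b * (q * of_nat n + p) = of_int (a * int n) + of_int b * p" for n
  proof -
    have "of_int b * q = of_int a" using b by (simp add: q)
    then show ?thesis by (simp add: distrib_left mult.assoc[symmetric])
  qed
  \<comment> \<open>With \<open>k\<close> the rounded value, \<open>b * k - a * n\<close> lies within distance \<open>b\<close> of \<open>b * p\<close>, independently of \<open>n\<close>.\<close>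
  have floor: "\<lfloor>of_int b * p\<rfloor> - b + 1 \<le> b * \<lfloor>q * of_nat n + p\<rfloor> - a * int n \<and>
      b * \<lfloor>q * of_nat n + p\<rfloor> - a * int n < \<lfloor>of_int b * p\<rfloor> - b + 1 + b" for n
  proof -
    define x where "x = q * of_nat n + p"
    have "of_int b * of_int \<lfloor>x\<rfloor> \<le> of_int b * x" "of_int b * x < of_int b * (of_int \<lfloor>x\<rfloor> + 1)"
      using b floor_correct[of x] by (auto intro!: mult_left_mono mult_strict_left_mono)
    then have "of_int (b * \<lfloor>x\<rfloor> - a * int n) \<le> of_int b * p"
       "of_int b * p < of_int (b * \<lfloor>x\<rfloor> - a * int n + b)"
      unfolding x_def bq by (simp_all add: algebra_simps)
    then have "b * \<lfloor>x\<rfloor> - a * int n \<le> \<lfloor>of_int b * p\<rfloor>"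
      "\<lfloor>of_int b * p\<rfloor> < b * \<lfloor>x\<rfloor> - a * int n + b"
      by (simp_all only: le_floor_iff floor_less_iff)
    then show ?thesis unfolding x_def[symmetric] by linarith
  qed
  have ceiling: "\<lceil>of_int b * p\<rceil> \<le> b * \<lceil>q * of_nat n + p\<rceil> - a * int n \<and>
      b * \<lceil>q * of_nat n + p\<rceil> - a * int n < \<lceil>of_int b * p\<rceil> + b" for n
  proof -
    define x where "x = q * of_nat n + p"
    have "of_int b * of_int \<lceil>x\<rceil> \<ge> of_int b * x" "of_int b * x > of_int b * (of_int \<lceil>x\<rceil> - 1)"
      using b ceiling_correct[of x] by (auto intro!: mult_left_mono mult_strict_left_mono)
    then have "of_int (b * \<lceil>x\<rceil> - a * int n) \<ge> of_int b * p"
       "of_int b * p > of_int (b * \<lceil>x\<rceil> - a * int n - b)"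
      unfolding x_def bq by (simp_all add: algebra_simps)
    then have "\<lceil>of_int b * p\<rceil> \<le> b * \<lceil>x\<rceil> - a * int n"
      "b * \<lceil>x\<rceil> - a * int n - b < \<lceil>of_int b * p\<rceil>"
      by (simp_all only: ceiling_le_iff less_ceiling_iff)
    then show ?thesis unfolding x_def[symmetric] by linarith
  qed
  show ?thesis by (rule conjI[OF line_algebraic[OF b floor] line_algebraic[OF b ceiling]])
qed

end
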